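(* Let $0<\alpha<1$, let $k\ge 1$ be an integer and $\lambda>0$, and let $N_\alpha(t)=N(Y_\alpha(t))$, $t\ge 0$, be the fractional Poisson process of order $k$, where $N$ is the Poisson process of order $k$ with parameter $\lambda$ and $Y_\alpha$ is an inverse $\alpha$-stable subordinator independent of $N$. Then the process $\{N_\alpha(t);\, t\ge 0\}$ has the long-range dependence property.
   Context: Poisson process of order $k$ with parameter $\lambda$: $N(t)=X_1+\dots+X_{N_1(t)}$ (with $N(t)=0$ if $N_1(t)=0$), where $X_1,X_2,\dots$ are i.i.d. with $\mathbb{P}[X_i=m]=1/k$ for $m=1,\dots,k$, and $N_1=\{N_1(t);\,t\ge 0\}$ is a homogeneous Poisson process with intensity $k\lambda$, independent of $\{X_i\}_{i\ge1}$. Inverse $\alpha$-stable subordinator: let $\{\mathcal{L}_\alpha(t);\,t\ge 0\}$ be the $\alpha$-stable L\'evy subordinator, i.e. the L\'evy process with $\mathbb{E}[e^{-s\mathcal{L}_\alpha(t)}]=e^{-ts^\alpha}$, $s\ge 0$. Then $Y_\alpha(t)=\inf\{u>0:\mathcal{L}_\alpha(u)>t\}$, $t\ge 0$. Long-range dependence (LRD) property: a process $\{X(t);\,t\ge 0\}$ has the LRD property if there is an exponent $d\in(0,1)$ such that for every fixed $s>0$ there is a constant $c(s)\in(0,\infty)$ with $$\lim_{t\to\infty}\frac{\mathrm{Corr}(X(s),X(t))}{t^{-d}}=c(s),$$ where $\mathrm{Corr}$ denotes the correlation function of the process $X$. *)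

theory Defs
  imports "HOL-Probability.Probability"
begin

text \<open>
  Processes are functions of time and outcome; only the values at times \<open>t \<ge> 0\<close> matter.
  Sample paths are required to be right-continuous with left limits for every outcome, not just
  almost surely. Otherwise \<open>N (Y t \<omega>) \<omega>\<close> could fail to be measurable on a null set of an
  incomplete space.
\<close>

definition cadlag :: "(real \<Rightarrow> 'b::topological_space) \<Rightarrow> bool" where
  "cadlag f \<longleftrightarrow>
     (\<forall>t\<ge>0. (f \<longlongrightarrow> f t) (at_right t)) \<and> (\<forall>t>0. \<exists>l. (f \<longlongrightarrow> l) (at_left t))"

definition independent_increments :: "'a measure \<Rightarrow> (real \<Rightarrow> 'a \<Rightarrow> real) \<Rightarrow> bool" where
  "independent_increments M X \<longleftrightarrow>
     (\<forall>(n::nat) (t::nat \<Rightarrow> real). 0 \<le> t 0 \<and> mono_on {..n} t \<longrightarrow>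
        prob_space.indep_vars M (\<lambda>_. borel) (\<lambda>i \<omega>. X (t (Suc i)) \<omega> - X (t i) \<omega>) {..<n})"

definition stationary_increments :: "'a measure \<Rightarrow> (real \<Rightarrow> 'a \<Rightarrow> real) \<Rightarrow> bool" where
  "stationary_increments M X \<longleftrightarrow>
     (\<forall>s\<ge>0. \<forall>h\<ge>0. distr M borel (\<lambda>\<omega>. X (s + h) \<omega> - X s \<omega>) =
                      distr M borel (\<lambda>\<omega>. X h \<omega> - X 0 \<omega>))"

text \<open>Stochastic continuity is not listed because it follows from right-continuity of the paths
  and stationarity of the increments.\<close>

definition levy_process :: "'a measure \<Rightarrow> (real \<Rightarrow> 'a \<Rightarrow> real) \<Rightarrow> bool" where
  "levy_process M X \<longleftrightarrow>
     (\<forall>t\<ge>0. X t \<in> borel_measurable M) \<and>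
     (AE \<omega> in M. X 0 \<omega> = 0) \<and>
     independent_increments M X \<and>
     stationary_increments M X \<and>
     (\<forall>\<omega>\<in>space M. cadlag (\<lambda>t. X t \<omega>))"

definition subordinator :: "'a measure \<Rightarrow> (real \<Rightarrow> 'a \<Rightarrow> real) \<Rightarrow> bool" where
  "subordinator M X \<longleftrightarrow>
     levy_process M X \<and> (AE \<omega> in M. mono_on {0..} (\<lambda>t. X t \<omega>))"

definition stable_subordinator :: "'a measure \<Rightarrow> real \<Rightarrow> (real \<Rightarrow> 'a \<Rightarrow> real) \<Rightarrow> bool" where
  "stable_subordinator M \<alpha> L \<longleftrightarrow>
     subordinator M L \<and>
     (\<forall>t\<ge>0. \<forall>s\<ge>0. (LINT \<omega>|M. exp (- s * L t \<omega>)) = exp (- t * s powr \<alpha>))"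

text \<open>A path of a stable subordinator is almost surely unbounded, so the \<open>else\<close> branch concerns
  a null event only; it is there because \<open>Inf {}\<close> is an unspecified, possibly negative, real.\<close>

definition first_passage :: "(real \<Rightarrow> 'a \<Rightarrow> real) \<Rightarrow> real \<Rightarrow> 'a \<Rightarrow> real" where
  "first_passage L t \<omega> =
     (if \<exists>u>0. L u \<omega> > t then Inf {u. u > 0 \<and> L u \<omega> > t} else 0)"

definition inverse_stable_subordinator ::
    "'a measure \<Rightarrow> real \<Rightarrow> (real \<Rightarrow> 'a \<Rightarrow> real) \<Rightarrow> bool" where
  "inverse_stable_subordinator M \<alpha> Y \<longleftrightarrow>
     (\<exists>L. stable_subordinator M \<alpha> L \<and>
          (\<forall>t\<ge>0. \<forall>\<omega>\<in>space M. Y t \<omega> = first_passage L t \<omega>))"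

definition poisson_process :: "'a measure \<Rightarrow> real \<Rightarrow> (real \<Rightarrow> 'a \<Rightarrow> nat) \<Rightarrow> bool" where
  "poisson_process M \<mu> N \<longleftrightarrow>
     (\<forall>t\<ge>0. N t \<in> measurable M (count_space UNIV)) \<and>
     (AE \<omega> in M. N 0 \<omega> = 0) \<and>
     independent_increments M (\<lambda>t \<omega>. real (N t \<omega>)) \<and>
     (\<forall>s\<ge>0. \<forall>h>0. \<forall>n. measure M {\<omega>\<in>space M. N (s + h) \<omega> = N s \<omega> + n} = pmf (poisson_pmf (\<mu> * h)) n) \<and>
     (\<forall>\<omega>\<in>space M. cadlag (\<lambda>t. N t \<omega>))"

text \<open>Independence of processes means independence of the random elements of the product space
  over the index set, i.e. of the sigma-algebras the processes generate.
  The constant \<open>indep_var\<close> does not apply when the two have different types.\<close>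

definition independent_processes ::
    "'a measure \<Rightarrow> 'i set \<Rightarrow> 'b measure \<Rightarrow> ('i \<Rightarrow> 'a \<Rightarrow> 'b) \<Rightarrow>
     'j set \<Rightarrow> 'c measure \<Rightarrow> ('j \<Rightarrow> 'a \<Rightarrow> 'c) \<Rightarrow> bool" where
  "independent_processes M I A X J B Y \<longleftrightarrow>
     (let \<X> = (\<lambda>\<omega>. \<lambda>i\<in>I. X i \<omega>); \<Y> = (\<lambda>\<omega>. \<lambda>j\<in>J. Y j \<omega>);
          \<A> = PiM I (\<lambda>_. A); \<B> = PiM J (\<lambda>_. B) in
        \<X> \<in> measurable M \<A> \<and> \<Y> \<in> measurable M \<B> \<and>
        prob_space.indep_set M {\<X> -` S \<inter> space M | S. S \<in> sets \<A>}
                               {\<Y> -` T \<inter> space M | T. T \<in> sets \<B>})"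

definition poisson_process_of_order ::
    "'a measure \<Rightarrow> nat \<Rightarrow> real \<Rightarrow> (real \<Rightarrow> 'a \<Rightarrow> nat) \<Rightarrow> bool" where
  "poisson_process_of_order M k l N \<longleftrightarrow>
     (\<exists>(N1 :: real \<Rightarrow> 'a \<Rightarrow> nat) (X :: nat \<Rightarrow> 'a \<Rightarrow> nat).
        poisson_process M (real k * l) N1 \<and>
        prob_space.indep_vars M (\<lambda>_. count_space UNIV) X {1..} \<and>
        (\<forall>i\<ge>1. \<forall>m\<in>{1..k}. measure M {\<omega>\<in>space M. X i \<omega> = m} = 1 / real k) \<and>
        independent_processes M {0..} (count_space UNIV) N1 {1..} (count_space UNIV) X \<and>
        (\<forall>t\<ge>0. \<forall>\<omega>\<in>space M. N t \<omega> = (\<Sum>i=1..N1 t \<omega>. X i \<omega>)))"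

definition covariance :: "'a measure \<Rightarrow> ('a \<Rightarrow> real) \<Rightarrow> ('a \<Rightarrow> real) \<Rightarrow> real" where
  "covariance M U V =
     (LINT \<omega>|M. (U \<omega> - integral\<^sup>L M U) * (V \<omega> - integral\<^sup>L M V))"

definition correlation :: "'a measure \<Rightarrow> ('a \<Rightarrow> real) \<Rightarrow> ('a \<Rightarrow> real) \<Rightarrow> real" where
  "correlation M U V = covariance M U V / sqrt (covariance M U U * covariance M V V)"

text \<open>Square integrability makes the correlation function meaningful: the Bochner integral of a
  non-integrable function is \<open>0\<close>.\<close>

definition long_range_dependent :: "'a measure \<Rightarrow> (real \<Rightarrow> 'a \<Rightarrow> real) \<Rightarrow> bool" where
  "long_range_dependent M X \<longleftrightarrow>
     (\<forall>t\<ge>0. X t \<in> borel_measurable M \<and> integrable M (\<lambda>\<omega>. (X t \<omega>)\<^sup>2)) \<and>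
     (\<exists>d. 0 < d \<and> d < 1 \<and>
        (\<forall>s>0. \<exists>c>0. ((\<lambda>t. correlation M (X s) (X t) / t powr (- d)) \<longlongrightarrow> c) at_top))"

end

theory Submission
  imports Defs
begin

text \<open>
  Write \<open>m\<close> and \<open>v\<close> for the mean and the variance of \<open>N 1\<close>, so that \<open>N\<close> has mean \<open>m t\<close> and covariance
  \<open>v (min s t)\<close>. Conditioning on the time change \<open>Y\<close>, which is independent of \<open>N\<close> and nondecreasing,
  gives for \<open>s \<le> t\<close>
    \<open>Cov (N (Y s)) (N (Y t)) = v E[Y s] + m\<^sup>2 Cov (Y s) (Y t)\<close>,
  and everything is reduced to the first two moments of the inverse stable subordinator \<open>Y\<close>.

  These come from the potential measure \<open>U A = \<integral>\<^sub>0\<^sup>\<infinity> P (L a \<in> A) da\<close> of the stable subordinator \<open>L\<close>.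
  Integrating \<open>E[exp (- s L a)] = exp (- a s\<^sup>\<alpha>)\<close> over \<open>a\<close> shows that \<open>U\<close> has Laplace transform
  \<open>s\<^sup>-\<^sup>\<alpha>\<close>, hence density \<open>x\<^sup>\<alpha>\<^sup>-\<^sup>1 / \<Gamma>(\<alpha>)\<close> (\<open>potential_measure_eq\<close>). The set of those \<open>a \<ge> 0\<close> with
  \<open>L a \<le> t\<close> is an interval of length \<open>Y t\<close>, so \<open>E[Y t] = U [0, t] = V t\<close> with \<open>V t = t\<^sup>\<alpha> / \<Gamma>(\<alpha> + 1)\<close>.
  In the same way, with \<open>L (a + h) - L a\<close> independent of \<open>L a\<close>,
    \<open>E[Y s Y t] = q s t + q s s\<close>, where \<open>q s t = \<integral>\<^sub>[\<^sub>0\<^sub>,\<^sub>s\<^sub>] V (t - x) U(dx)\<close> for \<open>s \<le> t\<close>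
  (\<open>expected_double_sojourn\<close>, \<open>first_passage_product_mean\<close>).

  For fixed \<open>s\<close> the difference \<open>q s t - V s * V t\<close> tends to \<open>0\<close>, because \<open>t\<^sup>\<alpha> - (t - s)\<^sup>\<alpha>\<close> does; so the
  covariance converges to the positive number \<open>v V s + m\<^sup>2 q s s\<close>. On the diagonal, scaling gives
  \<open>Var (Y t) = K t\<^sup>2\<^sup>\<alpha>\<close>, and \<open>K > 0\<close> because \<open>\<alpha> < 1\<close>; so the standard deviation of \<open>N (Y t)\<close> is
  asymptotically a positive multiple of \<open>t\<^sup>\<alpha>\<close>. The correlation therefore decays exactly like
  \<open>t\<^sup>-\<^sup>\<alpha>\<close>, and \<open>\<alpha>\<close> is the exponent of long-range dependence.
\<close>

section \<open>Joint measurability of right-continuous processes\<close>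

text \<open>
  A right-continuous process is the pointwise limit of processes that depend on time only through
  a countable grid, and each of these is measurable because each single \<open>X t\<close> is. Truncating time
  at \<open>0\<close> makes the statement one about the whole line, so that no restricted measure spaces occur
  later.
\<close>

lemma measurable_right_continuous_process:
  fixes X :: "real \<Rightarrow> 'a \<Rightarrow> real"
  assumes X: "\<And>t. t \<ge> 0 \<Longrightarrow> X t \<in> borel_measurable M"
    and right: "\<And>t \<omega>. t \<ge> 0 \<Longrightarrow> \<omega> \<in> space M \<Longrightarrow> ((\<lambda>u. X u \<omega>) \<longlongrightarrow> X t \<omega>) (at_right t)"
  shows "(\<lambda>(t, \<omega>). X (max t 0) \<omega>) \<in> borel_measurable (borel \<Otimes>\<^sub>M M)"
proof (rule borel_measurable_LIMSEQ_real)
  \<comment> \<open>The least point of the grid of mesh \<open>1 / Suc n\<close> that lies strictly to the right of \<open>t\<close>: strictness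
    lets the right-hand limit apply.\<close>
  define r where "r n t = real (nat \<lfloor>max t 0 * real (Suc n)\<rfloor> + 1) / real (Suc n)" for n t
  show "(\<lambda>(t, \<omega>). X (r n t) \<omega>) \<in> borel_measurable (borel \<Otimes>\<^sub>M M)" for n
  proof -
    have "(\<lambda>p. X (real (nat \<lfloor>max (fst p) 0 * real (Suc n)\<rfloor> + 1) / real (Suc n)) (snd p))
        \<in> borel_measurable (borel \<Otimes>\<^sub>M M)"
    proof (rule measurable_compose_countable[where f="\<lambda>i p. X (real (i + 1) / real (Suc n)) (snd p)"])
      show "(\<lambda>p. X (real (i + 1) / real (Suc n)) (snd p)) \<in> borel_measurable (borel \<Otimes>\<^sub>M M)" for i
        by (rule measurable_compose[OF measurable_snd X]) simp
      show "(\<lambda>p. nat \<lfloor>max (fst p) 0 * real (Suc n)\<rfloor>) \<in> measurable (borel \<Otimes>\<^sub>M M) (count_space UNIV)"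
        by measurable
    qed
    then show ?thesis unfolding r_def split_beta' .
  qed
  fix p :: "real \<times> 'a" assume "p \<in> space (borel \<Otimes>\<^sub>M M)"
  then obtain t \<omega> where p: "p = (t, \<omega>)" "\<omega> \<in> space M"
    by (auto simp: space_pair_measure)
  have bounds: "max t 0 < r n t \<and> r n t \<le> max t 0 + 1 / real (Suc n)" for n
  proof -
    define x where "x = max t 0"
    have x: "0 \<le> x" by (simp add: x_def)
    then have "real (nat \<lfloor>x * real (Suc n)\<rfloor>) = of_int \<lfloor>x * real (Suc n)\<rfloor>"
      by (intro of_nat_nat) (simp del: of_nat_Suc)
    then have "x * real (Suc n) < real (nat \<lfloor>x * real (Suc n)\<rfloor> + 1)"
      "real (nat \<lfloor>x * real (Suc n)\<rfloor> + 1) \<le> x * real (Suc n) + 1"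
      unfolding of_nat_add of_nat_1 by linarith+
    moreover have "x + 1 / real (Suc n) = (x * real (Suc n) + 1) / real (Suc n)"
      by (simp add: add_divide_distrib del: of_nat_Suc)
    ultimately show ?thesis
      unfolding r_def x_def[symmetric]
      by (simp add: pos_less_divide_eq divide_right_mono del: of_nat_Suc of_nat_add)
  qed
  have "(\<lambda>n. max t 0 + 1 / real (Suc n)) \<longlonglongrightarrow> max t 0 + 0"
    by (intro tendsto_add tendsto_const LIMSEQ_Suc[OF lim_1_over_n])
  then have upper: "(\<lambda>n. max t 0 + 1 / real (Suc n)) \<longlonglongrightarrow> max t 0" by (simp only: add_0_right)
  have "(\<lambda>n. r n t) \<longlonglongrightarrow> max t 0"
  proof (rule tendsto_sandwich[OF _ _ tendsto_const upper])
    show "\<forall>\<^sub>F n in sequentially. max t 0 \<le> r n t"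
      using bounds by (intro always_eventually allI) (metis less_imp_le)
    show "\<forall>\<^sub>F n in sequentially. r n t \<le> max t 0 + 1 / real (Suc n)"
      using bounds by (intro always_eventually allI) blast
  qed
  moreover have "\<forall>\<^sub>F n in sequentially. r n t \<in> {max t 0<..} \<and> r n t \<noteq> max t 0"
    by (intro always_eventually allI conjI) (use bounds in \<open>blast, metis less_irrefl\<close>)
  ultimately have "filterlim (\<lambda>n. r n t) (at_right (max t 0)) sequentially"
    unfolding filterlim_at by blast
  moreover have "((\<lambda>u. X u \<omega>) \<longlongrightarrow> X (max t 0) \<omega>) (at_right (max t 0))"
    by (rule right[OF _ p(2)]) simp
  ultimately show "(\<lambda>n. (\<lambda>(t, \<omega>). X (r n t) \<omega>) p) \<longlonglongrightarrow> (\<lambda>(t, \<omega>). X (max t 0) \<omega>) p"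
    unfolding p(1) prod.case by (rule filterlim_compose[rotated])
qed

section \<open>Independent random elements\<close>

lemma (in prob_space) indep_set_mono:
  assumes "indep_set A B" "A' \<subseteq> A" "B' \<subseteq> B"
  shows "indep_set A' B'"
  using assms(1) unfolding indep_set_def
  by (rule indep_sets_mono_sets) (use assms(2,3) in \<open>auto split: bool.split\<close>)

text \<open>
  The two random elements may take values in different types, which is why independence is given
  as independence of the generated sigma-algebras.
\<close>

lemma (in prob_space) distr_Pair_of_indep_set:
  assumes X[measurable]: "X \<in> measurable M A" and Y[measurable]: "Y \<in> measurable M B"
    and indep: "indep_set {X -` S \<inter> space M | S. S \<in> sets A} {Y -` T \<inter> space M | T. T \<in> sets B}"
  shows "distr M (A \<Otimes>\<^sub>M B) (\<lambda>\<omega>. (X \<omega>, Y \<omega>)) = distr M A X \<Otimes>\<^sub>M distr M B Y"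
proof (rule pair_measure_eqI[symmetric])
  interpret PX: prob_space "distr M A X" by (rule prob_space_distr) fact
  interpret PY: prob_space "distr M B Y" by (rule prob_space_distr) fact
  show "sigma_finite_measure (distr M A X)" "sigma_finite_measure (distr M B Y)" by unfold_locales
  show "sets (distr M A X \<Otimes>\<^sub>M distr M B Y) = sets (distr M (A \<Otimes>\<^sub>M B) (\<lambda>\<omega>. (X \<omega>, Y \<omega>)))"
    by (simp cong: sets_pair_measure_cong)
  fix S T assume ST: "S \<in> sets (distr M A X)" "T \<in> sets (distr M B Y)"
  have "prob ((X -` S \<inter> space M) \<inter> (Y -` T \<inter> space M)) = prob (X -` S \<inter> space M) * prob (Y -` T \<inter> space M)"
    using ST by (intro indep_setD[OF indep]) auto
  moreover have "(\<lambda>\<omega>. (X \<omega>, Y \<omega>)) -` (S \<times> T) \<inter> space M = (X -` S \<inter> space M) \<inter> (Y -` T \<inter> space M)"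
    by auto
  ultimately show "emeasure (distr M A X) S * emeasure (distr M B Y) T =
      emeasure (distr M (A \<Otimes>\<^sub>M B) (\<lambda>\<omega>. (X \<omega>, Y \<omega>))) (S \<times> T)"
    using ST by (simp add: emeasure_distr emeasure_eq_measure ennreal_mult'')
qed

text \<open>
  Tonelli for the product law: either one of two independent random elements may be integrated out
  first, with the other one frozen. This is the form in which independence is used below, for a
  Poisson process and its jumps as well as for a process and its random clock.
\<close>

lemma (in prob_space) nn_integral_indep_set:
  assumes X[measurable]: "X \<in> measurable M A" and Y[measurable]: "Y \<in> measurable M B"
    and indep: "indep_set {X -` S \<inter> space M | S. S \<in> sets A} {Y -` T \<inter> space M | T. T \<in> sets B}"
    and h[measurable]: "h \<in> borel_measurable (A \<Otimes>\<^sub>M B)"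
  shows "(\<integral>\<^sup>+\<omega>. h (X \<omega>, Y \<omega>) \<partial>M) = (\<integral>\<^sup>+\<omega>. (\<integral>\<^sup>+\<omega>'. h (X \<omega>', Y \<omega>) \<partial>M) \<partial>M)"
    and "(\<integral>\<^sup>+\<omega>. h (X \<omega>, Y \<omega>) \<partial>M) = (\<integral>\<^sup>+\<omega>. (\<integral>\<^sup>+\<omega>'. h (X \<omega>, Y \<omega>') \<partial>M) \<partial>M)"
proof -
  interpret PX: prob_space "distr M A X" by (rule prob_space_distr) fact
  interpret PY: prob_space "distr M B Y" by (rule prob_space_distr) fact
  interpret XY: pair_sigma_finite "distr M A X" "distr M B Y" by unfold_locales
  have meas: "h \<in> borel_measurable (distr M A X \<Otimes>\<^sub>M distr M B Y)"
    by (simp cong: measurable_cong_sets sets_pair_measure_cong)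
  have "(\<integral>\<^sup>+\<omega>. h (X \<omega>, Y \<omega>) \<partial>M) = (\<integral>\<^sup>+p. h p \<partial>(distr M A X \<Otimes>\<^sub>M distr M B Y))"
    unfolding distr_Pair_of_indep_set[OF X Y indep, symmetric] by (simp add: nn_integral_distr)
  also have eq: "\<dots> = (\<integral>\<^sup>+y. (\<integral>\<^sup>+x. h (x, y) \<partial>distr M A X) \<partial>distr M B Y)"
    by (rule XY.nn_integral_snd[symmetric]) (rule meas)
  also have "\<dots> = (\<integral>\<^sup>+\<omega>. (\<integral>\<^sup>+\<omega>'. h (X \<omega>', Y \<omega>) \<partial>M) \<partial>M)"
    by (subst nn_integral_distr[OF Y], measurable)
       (intro nn_integral_cong nn_integral_distr[OF X]; measurable)
  finally show "(\<integral>\<^sup>+\<omega>. h (X \<omega>, Y \<omega>) \<partial>M) = (\<integral>\<^sup>+\<omega>. (\<integral>\<^sup>+\<omega>'. h (X \<omega>', Y \<omega>) \<partial>M) \<partial>M)" .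
  have "(\<integral>\<^sup>+\<omega>. h (X \<omega>, Y \<omega>) \<partial>M) = (\<integral>\<^sup>+p. h p \<partial>(distr M A X \<Otimes>\<^sub>M distr M B Y))"
    unfolding distr_Pair_of_indep_set[OF X Y indep, symmetric] by (simp add: nn_integral_distr)
  also have "\<dots> = (\<integral>\<^sup>+x. (\<integral>\<^sup>+y. h (x, y) \<partial>distr M B Y) \<partial>distr M A X)"
    by (rule PY.nn_integral_fst[symmetric]) (rule meas)
  also have "\<dots> = (\<integral>\<^sup>+\<omega>. (\<integral>\<^sup>+\<omega>'. h (X \<omega>, Y \<omega>') \<partial>M) \<partial>M)"
    by (subst nn_integral_distr[OF X], measurable)
       (intro nn_integral_cong nn_integral_distr[OF Y]; measurable)
  finally show "(\<integral>\<^sup>+\<omega>. h (X \<omega>, Y \<omega>) \<partial>M) = (\<integral>\<^sup>+\<omega>. (\<integral>\<^sup>+\<omega>'. h (X \<omega>, Y \<omega>') \<partial>M) \<partial>M)" .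
qed

section \<open>Moments of the Poisson process\<close>

lemma sums_poisson_first_moment:
  fixes c :: real
  shows "(\<lambda>n. real n * (c ^ n / fact n)) sums (c * exp c)"
proof -
  have "(\<lambda>n. c * (c ^ n / fact n)) sums (c * exp c)"
    using exp_converges[of c] by (intro sums_mult) (simp add: field_simps)
  moreover have "c * (c ^ n / fact n) = real (Suc n) * (c ^ Suc n / fact (Suc n))" for n
    by (simp add: field_simps del: of_nat_Suc)
  ultimately have "(\<lambda>n. real (Suc n) * (c ^ Suc n / fact (Suc n))) sums (c * exp c)" by simp
  from sums_Suc[OF this] show ?thesis by simp
qed

text \<open>
  Cancelling one factor \<open>n\<close> against \<open>n!\<close> and shifting the index turns this series into the ones for
  the first moment and for \<open>exp\<close>.
\<close>

lemma sums_poisson_second_moment: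
  fixes c :: real
  shows "(\<lambda>n. (real n)\<^sup>2 * (c ^ n / fact n)) sums ((c + c\<^sup>2) * exp c)"
proof -
  have "(\<lambda>n. c * (real n * (c ^ n / fact n) + c ^ n / fact n)) sums (c * (c * exp c + exp c))"
    using exp_converges[of c] by (intro sums_mult sums_add sums_poisson_first_moment) (simp add: field_simps)
  moreover have "c * (real n * (c ^ n / fact n) + c ^ n / fact n) = (real (Suc n))\<^sup>2 * (c ^ Suc n / fact (Suc n))" for n
  proof -
    have "c * (real n * (c ^ n / fact n) + c ^ n / fact n) = real (Suc n) * (c ^ Suc n / fact n)"
      by (simp add: field_simps)
    also have "\<dots> = (real (Suc n))\<^sup>2 * (c ^ Suc n / fact (Suc n))"
      by (simp add: field_simps power2_eq_square del: of_nat_Suc)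
    finally show ?thesis .
  qed
  ultimately have "(\<lambda>n. (real (Suc n))\<^sup>2 * (c ^ Suc n / fact (Suc n))) sums (c * (c * exp c + exp c))" by simp
  from sums_Suc[OF this] show ?thesis by (simp add: algebra_simps power2_eq_square)
qed

lemma nn_integral_poisson_pmf:
  assumes "0 < c"
  shows "(\<integral>\<^sup>+n. ennreal (real n) \<partial>measure_pmf (poisson_pmf c)) = ennreal c"
    and "(\<integral>\<^sup>+n. ennreal ((real n)\<^sup>2) \<partial>measure_pmf (poisson_pmf c)) = ennreal (c + c\<^sup>2)"
proof -
  have *: "(\<integral>\<^sup>+n. ennreal (f n) \<partial>measure_pmf (poisson_pmf c)) = ennreal (x * exp (- c))"
    if "(\<lambda>n. f n * (c ^ n / fact n)) sums x" "\<And>n. 0 \<le> f n" for f x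
  proof -
    have "(\<lambda>n. f n * (c ^ n / fact n) * exp (- c)) sums (x * exp (- c))"
      by (intro sums_mult2 that)
    then have "(\<Sum>n. ennreal (f n * (c ^ n / fact n) * exp (- c))) = ennreal (x * exp (- c))"
      using that(2) assms by (intro suminf_ennreal_eq) auto
    then show ?thesis
      using that(2) assms
      by (simp add: nn_integral_measure_pmf nn_integral_count_space_nat ennreal_mult'[symmetric] ac_simps)
  qed
  show "(\<integral>\<^sup>+n. ennreal (real n) \<partial>measure_pmf (poisson_pmf c)) = ennreal c"
    using *[OF sums_poisson_first_moment[of c]] by (simp add: mult.assoc exp_minus)
  show "(\<integral>\<^sup>+n. ennreal ((real n)\<^sup>2) \<partial>measure_pmf (poisson_pmf c)) = ennreal (c + c\<^sup>2)"
    using *[OF sums_poisson_second_moment[of c]] by (simp add: mult.assoc exp_minus)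
qed

text \<open>
  The masses of the Poisson distribution sum to \<open>1\<close>, and they are the probabilities of the disjoint
  events that the increment equals \<open>n \<ge> 0\<close>. So the increment is almost surely nonnegative, and the
  truncated difference on the natural numbers has the Poisson law.
\<close>

lemma (in prob_space) poisson_increment:
  assumes P: "poisson_process M c P" and c: "0 < c" and s: "0 \<le> s" "0 < h"
  shows "AE \<omega> in M. P s \<omega> \<le> P (s + h) \<omega>"
    and "distr M (count_space UNIV) (\<lambda>\<omega>. P (s + h) \<omega> - P s \<omega>) = measure_pmf (poisson_pmf (c * h))"
proof -
  have [measurable]: "P s \<in> measurable M (count_space UNIV)" "P (s + h) \<in> measurable M (count_space UNIV)"
    using P s by (auto simp: poisson_process_def)
  let ?E = "\<lambda>n. {\<omega>\<in>space M. P (s + h) \<omega> = P s \<omega> + n}"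
  have pmf: "prob (?E n) = pmf (poisson_pmf (c * h)) n" for n
    using P s by (auto simp: poisson_process_def)
  have "{\<omega>\<in>space M. real (P (s + h) \<omega>) = real (P s \<omega>) + real n} \<in> events" for n
    by measurable
  then have E[measurable]: "?E n \<in> events" for n
    by (simp only: of_nat_add[symmetric] of_nat_eq_iff)
  have "emeasure M (\<Union>n. ?E n) = (\<Sum>n. emeasure M (?E n))"
    by (rule suminf_emeasure[symmetric]) (use E in \<open>auto simp: disjoint_family_on_def\<close>)
  also have "\<dots> = (\<integral>\<^sup>+n. 1 \<partial>measure_pmf (poisson_pmf (c * h)))"
    by (simp only: nn_integral_measure_pmf nn_integral_count_space_nat emeasure_eq_measure pmf mult_1_right)
  also have "\<dots> = 1" by simp
  finally have "prob (\<Union>n. ?E n) = 1" by (simp add: emeasure_eq_measure)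
  then have "AE \<omega> in M. \<omega> \<in> (\<Union>n. ?E n)" by (rule AE_prob_1)
  then show le: "AE \<omega> in M. P s \<omega> \<le> P (s + h) \<omega>" by eventually_elim auto
  show "distr M (count_space UNIV) (\<lambda>\<omega>. P (s + h) \<omega> - P s \<omega>) = measure_pmf (poisson_pmf (c * h))"
  proof (rule measure_eqI_countable)
    fix n :: nat
    have "emeasure M ((\<lambda>\<omega>. P (s + h) \<omega> - P s \<omega>) -` {n} \<inter> space M) = emeasure M (?E n)"
      by (rule emeasure_eq_AE) (use le in \<open>auto elim!: eventually_mono\<close>)
    then show "emeasure (distr M (count_space UNIV) (\<lambda>\<omega>. P (s + h) \<omega> - P s \<omega>)) {n} =
        emeasure (measure_pmf (poisson_pmf (c * h))) {n}"
      by (simp add: emeasure_distr emeasure_eq_measure pmf emeasure_pmf_single)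
  qed auto
qed

lemma (in prob_space) poisson_process_mono:
  assumes P: "poisson_process M c P" and c: "0 < c" and s: "0 \<le> s" "s \<le> t"
  shows "AE \<omega> in M. P s \<omega> \<le> P t \<omega>"
  using poisson_increment(1)[OF P c, of s "t - s"] s by (cases "s = t") auto

lemma (in prob_space) poisson_increment_mean:
  assumes P: "poisson_process M c P" and c: "0 < c" and s: "0 \<le> s" "0 \<le> h"
  shows "(\<integral>\<^sup>+\<omega>. ennreal (real (P (s + h) \<omega> - P s \<omega>)) \<partial>M) = ennreal (c * h)"
proof (cases "h = 0")
  case False
  then have h: "0 < h" using s by simp
  have [measurable]: "P s \<in> measurable M (count_space UNIV)" "P (s + h) \<in> measurable M (count_space UNIV)"
    using P s by (auto simp: poisson_process_def)
  have "(\<integral>\<^sup>+\<omega>. ennreal (real (P (s + h) \<omega> - P s \<omega>)) \<partial>M) =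
    (\<integral>\<^sup>+n. ennreal (real n) \<partial>distr M (count_space UNIV) (\<lambda>\<omega>. P (s + h) \<omega> - P s \<omega>))"
    by (subst nn_integral_distr) auto
  also have "\<dots> = ennreal (c * h)"
    using c h by (simp only: poisson_increment(2)[OF P c s(1) h] nn_integral_poisson_pmf(1) mult_pos_pos)
  finally show ?thesis .
qed simp

text \<open>
  For \<open>s \<le> t\<close> split \<open>P s * P t = (P s)\<^sup>2 + P s * (P t - P s)\<close>; the two factors of the last product are
  independent.
\<close>

lemma (in prob_space) poisson_process_moments:
  assumes P: "poisson_process M c P" and c: "0 < c" and s: "0 \<le> s" "s \<le> t"
  shows "(\<integral>\<^sup>+\<omega>. ennreal (real (P s \<omega>)) \<partial>M) = ennreal (c * s)"
    and "(\<integral>\<^sup>+\<omega>. ennreal (real (P s \<omega>) * real (P t \<omega>)) \<partial>M) = ennreal (c * s + c\<^sup>2 * s * t)"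
proof -
  have meas: "P u \<in> measurable M (count_space UNIV)" if "0 \<le> u" for u
    using P that by (auto simp: poisson_process_def)
  note [measurable] = meas[OF s(1)] meas[of t] meas[of 0]
  have P0: "AE \<omega> in M. P 0 \<omega> = 0" using P by (auto simp: poisson_process_def)
  show mean: "(\<integral>\<^sup>+\<omega>. ennreal (real (P s \<omega>)) \<partial>M) = ennreal (c * s)"
    using poisson_increment_mean[OF P c order_refl s(1)] P0
    by (subst nn_integral_cong_AE[where v="\<lambda>\<omega>. ennreal (real (P (0 + s) \<omega> - P 0 \<omega>))"])
       (auto elim!: eventually_mono)
  have sq: "(\<integral>\<^sup>+\<omega>. ennreal ((real (P s \<omega>))\<^sup>2) \<partial>M) = ennreal (c * s + (c * s)\<^sup>2)"
  proof (cases "s = 0")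
    case True
    then show ?thesis using P0 by (subst nn_integral_cong_AE[where v="\<lambda>_. 0"]) (auto elim!: eventually_mono)
  next
    case False
    then have "0 < s" using s by simp
    have "(\<integral>\<^sup>+\<omega>. ennreal ((real (P s \<omega>))\<^sup>2) \<partial>M) = (\<integral>\<^sup>+\<omega>. ennreal ((real (P (0 + s) \<omega> - P 0 \<omega>))\<^sup>2) \<partial>M)"
      by (rule nn_integral_cong_AE) (use P0 in \<open>auto elim!: eventually_mono\<close>)
    also have "\<dots> = (\<integral>\<^sup>+n. ennreal ((real n)\<^sup>2) \<partial>distr M (count_space UNIV) (\<lambda>\<omega>. P (0 + s) \<omega> - P 0 \<omega>))"
      using s by (subst nn_integral_distr) auto
    also have "\<dots> = ennreal (c * s + (c * s)\<^sup>2)"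
      using c \<open>0 < s\<close> by (simp only: poisson_increment(2)[OF P c order_refl \<open>0 < s\<close>] nn_integral_poisson_pmf(2) mult_pos_pos)
    finally show ?thesis .
  qed
  \<comment> \<open>The partition \<open>0 \<le> s \<le> t\<close> makes the value at \<open>s\<close>, up to the value at \<open>0\<close>, and the increment from
    \<open>s\<close> to \<open>t\<close> independent.\<close>
  define \<tau> :: "nat \<Rightarrow> real" where "\<tau> i = (if i = 0 then 0 else if i = 1 then s else t)" for i
  let ?I = "\<lambda>i \<omega>. real (P (\<tau> (Suc i)) \<omega>) - real (P (\<tau> i) \<omega>)"
  have "indep_vars (\<lambda>_. borel) ?I {..<2}"
    using P s unfolding poisson_process_def independent_increments_def
    by (elim conjE allE[of _ 2] allE[of _ \<tau>] mp) (auto simp: \<tau>_def mono_on_def)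
  then have "indep_vars (\<lambda>_. borel) (\<lambda>i \<omega>. ennreal (?I i \<omega>)) {..<2}"
    by (rule indep_vars_compose2) auto
  then have "(\<integral>\<^sup>+\<omega>. (\<Prod>i<2. ennreal (?I i \<omega>)) \<partial>M) = (\<Prod>i<2. \<integral>\<^sup>+\<omega>. ennreal (?I i \<omega>) \<partial>M)"
    by (intro indep_vars_nn_integral) auto
  then have "(\<integral>\<^sup>+\<omega>. ennreal (real (P s \<omega>) - real (P 0 \<omega>)) * ennreal (real (P t \<omega>) - real (P s \<omega>)) \<partial>M) =
    (\<integral>\<^sup>+\<omega>. ennreal (real (P s \<omega>) - real (P 0 \<omega>)) \<partial>M) * (\<integral>\<^sup>+\<omega>. ennreal (real (P t \<omega>) - real (P s \<omega>)) \<partial>M)"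
    by (simp add: numeral_2_eq_2 \<tau>_def)
  also have "(\<integral>\<^sup>+\<omega>. ennreal (real (P s \<omega>) - real (P 0 \<omega>)) \<partial>M) = ennreal (c * s)"
    unfolding mean[symmetric] by (rule nn_integral_cong_AE) (use P0 in \<open>auto elim!: eventually_mono\<close>)
  also have "(\<integral>\<^sup>+\<omega>. ennreal (real (P t \<omega>) - real (P s \<omega>)) \<partial>M) = ennreal (c * (t - s))"
    using poisson_increment_mean[OF P c s(1), of "t - s"] s poisson_process_mono[OF P c s]
    by (subst nn_integral_cong_AE[where v="\<lambda>\<omega>. ennreal (real (P (s + (t - s)) \<omega> - P s \<omega>))"])
       (auto elim!: eventually_mono simp: of_nat_diff)
  finally have cross: "(\<integral>\<^sup>+\<omega>. ennreal (real (P s \<omega>) * (real (P t \<omega>) - real (P s \<omega>))) \<partial>M) = ennreal (c * s) * ennreal (c * (t - s))"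
    by (subst nn_integral_cong_AE[where v="\<lambda>\<omega>. ennreal (real (P s \<omega>) - real (P 0 \<omega>)) * ennreal (real (P t \<omega>) - real (P s \<omega>))"])
       (use P0 in \<open>auto elim!: eventually_mono simp: ennreal_mult'\<close>)
  have "(\<integral>\<^sup>+\<omega>. ennreal (real (P s \<omega>) * real (P t \<omega>)) \<partial>M) =
    (\<integral>\<^sup>+\<omega>. ennreal ((real (P s \<omega>))\<^sup>2) + ennreal (real (P s \<omega>) * (real (P t \<omega>) - real (P s \<omega>))) \<partial>M)"
  proof (rule nn_integral_cong_AE)
    show "AE \<omega> in M. ennreal (real (P s \<omega>) * real (P t \<omega>)) =
      ennreal ((real (P s \<omega>))\<^sup>2) + ennreal (real (P s \<omega>) * (real (P t \<omega>) - real (P s \<omega>)))"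
      using poisson_process_mono[OF P c s]
      by eventually_elim (simp add: ennreal_plus[symmetric] power2_eq_square algebra_simps mult_mono del: ennreal_plus)
  qed
  also have "\<dots> = ennreal (c * s + (c * s)\<^sup>2) + ennreal (c * s) * ennreal (c * (t - s))"
    using s by (subst nn_integral_add) (auto simp: sq cross)
  also have "\<dots> = ennreal (c * s + (c * s)\<^sup>2 + c * s * (c * (t - s)))"
    using s c by (simp add: ennreal_mult')
  also have "c * s + (c * s)\<^sup>2 + c * s * (c * (t - s)) = c * s + c\<^sup>2 * s * t"
    by (simp add: power2_eq_square algebra_simps)
  finally show "(\<integral>\<^sup>+\<omega>. ennreal (real (P s \<omega>) * real (P t \<omega>)) \<partial>M) = ennreal (c * s + c\<^sup>2 * s * t)" .
qed

section \<open>Moments of the Poisson process of order k\<close>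

text \<open>
  The prescribed point masses already add up to \<open>1\<close>, so the jump lies in \<open>{1..k}\<close> almost surely and
  its integral is an average over \<open>{1..k}\<close>.
\<close>

lemma (in prob_space) uniform_jump_nn_integral:
  fixes J :: "'a \<Rightarrow> nat"
  assumes [measurable]: "J \<in> measurable M (count_space UNIV)"
    and k: "k \<ge> 1" and unif: "\<And>m. m \<in> {1..k} \<Longrightarrow> prob {\<omega>\<in>space M. J \<omega> = m} = 1 / real k"
    and f: "\<And>m. 0 \<le> f m"
  shows "(\<integral>\<^sup>+\<omega>. ennreal (f (J \<omega>)) \<partial>M) = ennreal ((\<Sum>m=1..k. f m) / real k)"
proof -
  let ?E = "\<lambda>m. {\<omega>\<in>space M. J \<omega> = m}"
  have "prob (\<Union>m\<in>{1..k}. ?E m) = (\<Sum>m\<in>{1..k}. prob (?E m))"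
    by (rule finite_measure_finite_Union) (auto simp: disjoint_family_on_def)
  also have "\<dots> = 1" using k by (simp add: unif)
  finally have "AE \<omega> in M. \<omega> \<in> (\<Union>m\<in>{1..k}. ?E m)" by (rule AE_prob_1)
  then have "(\<integral>\<^sup>+\<omega>. ennreal (f (J \<omega>)) \<partial>M) = (\<integral>\<^sup>+\<omega>. (\<Sum>m=1..k. ennreal (f m) * indicator (?E m) \<omega>) \<partial>M)"
  proof (intro nn_integral_cong_AE, eventually_elim)
    case (elim \<omega>)
    then have "J \<omega> \<in> {1..k}" "\<omega> \<in> space M" by auto
    then have "(\<Sum>m=1..k. ennreal (f m) * indicator (?E m) \<omega>) = (\<Sum>m=1..k. if m = J \<omega> then ennreal (f m) else 0)"
      by (intro sum.cong) (auto simp: indicator_def)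
    then show ?case using \<open>J \<omega> \<in> {1..k}\<close> by (simp del: atLeastAtMost_iff)
  qed
  also have "\<dots> = (\<Sum>m=1..k. ennreal (f m) * emeasure M (?E m))"
    by (subst nn_integral_sum) (measurable, intro sum.cong refl nn_integral_cmult_indicator, measurable)
  also have "\<dots> = (\<Sum>m=1..k. ennreal (f m / real k))"
    by (intro sum.cong) (simp_all only: emeasure_eq_measure unif refl ennreal_mult'[OF f, symmetric], simp)
  also have "\<dots> = ennreal ((\<Sum>m=1..k. f m) / real k)"
    using f by (simp add: sum_ennreal sum_divide_distrib)
  finally show ?thesis .
qed

text \<open>
  For \<open>a \<le> b\<close>, in the double sum for the product exactly \<open>a\<close> of the \<open>a * b\<close> terms are diagonal. They have
  expectation \<open>\<sigma>\<close>, the second moment of a jump, and all the others have expectation \<open>\<mu>\<^sup>2\<close>.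
\<close>

lemma (in prob_space) uniform_jump_sums:
  fixes X :: "nat \<Rightarrow> 'a \<Rightarrow> nat"
  assumes indep: "indep_vars (\<lambda>_. count_space UNIV) X {1..}"
    and k: "k \<ge> 1" and unif: "\<And>i m. i \<ge> 1 \<Longrightarrow> m \<in> {1..k} \<Longrightarrow> prob {\<omega>\<in>space M. X i \<omega> = m} = 1 / real k"
  defines "\<mu> \<equiv> (\<Sum>m=1..k. real m) / real k" and "\<sigma> \<equiv> (\<Sum>m=1..k. (real m)\<^sup>2) / real k"
  shows "(\<integral>\<^sup>+\<omega>. ennreal (real (\<Sum>i=1..a. X i \<omega>)) \<partial>M) = ennreal (real a * \<mu>)"
    and "a \<le> b \<Longrightarrow> (\<integral>\<^sup>+\<omega>. ennreal (real (\<Sum>i=1..a. X i \<omega>) * real (\<Sum>j=1..b. X j \<omega>)) \<partial>M) =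
      ennreal (real a * (\<sigma> - \<mu>\<^sup>2) + real a * real b * \<mu>\<^sup>2)"
proof -
  have X: "X i \<in> measurable M (count_space UNIV)" if "i \<ge> 1" for i
    using indep that unfolding indep_vars_def by auto
  have \<mu>0: "0 \<le> \<mu>" and \<sigma>0: "0 \<le> \<sigma>" by (simp_all add: \<mu>_def \<sigma>_def sum_nonneg)
  have mean: "(\<integral>\<^sup>+\<omega>. ennreal (real (X i \<omega>)) \<partial>M) = ennreal \<mu>" if "i \<ge> 1" for i
    unfolding \<mu>_def by (rule uniform_jump_nn_integral[OF X[OF that] k unif[OF that]]) auto
  have square: "(\<integral>\<^sup>+\<omega>. ennreal (real (X i \<omega>) * real (X i \<omega>)) \<partial>M) = ennreal \<sigma>" if "i \<ge> 1" for i
    using uniform_jump_nn_integral[OF X[OF that] k unif[OF that], of "\<lambda>m. (real m)\<^sup>2"]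
    by (simp add: \<sigma>_def power2_eq_square)
  have prod: "(\<integral>\<^sup>+\<omega>. ennreal (real (X i \<omega>) * real (X j \<omega>)) \<partial>M) = ennreal (\<mu>\<^sup>2)"
    if ij: "i \<ge> 1" "j \<ge> 1" "i \<noteq> j" for i j
  proof -
    have "indep_vars (\<lambda>_. borel) (\<lambda>i \<omega>. ennreal (real (X i \<omega>))) {i, j}"
      by (rule indep_vars_compose2[OF indep_vars_subset[OF indep]]) (use ij in auto)
    then have "(\<integral>\<^sup>+\<omega>. (\<Prod>n\<in>{i, j}. ennreal (real (X n \<omega>))) \<partial>M) = (\<Prod>n\<in>{i, j}. \<integral>\<^sup>+\<omega>. ennreal (real (X n \<omega>)) \<partial>M)"
      by (intro indep_vars_nn_integral) auto
    then show ?thesis using ij \<mu>0 by (simp add: mean power2_eq_square ennreal_mult')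
  qed
  show "(\<integral>\<^sup>+\<omega>. ennreal (real (\<Sum>i=1..a. X i \<omega>)) \<partial>M) = ennreal (real a * \<mu>)"
  proof -
    have "(\<integral>\<^sup>+\<omega>. ennreal (real (\<Sum>i=1..a. X i \<omega>)) \<partial>M) = (\<integral>\<^sup>+\<omega>. (\<Sum>i=1..a. ennreal (real (X i \<omega>))) \<partial>M)"
      by (simp add: sum_ennreal)
    also have "\<dots> = (\<Sum>i=1..a. ennreal \<mu>)"
      by (subst nn_integral_sum) (use X in \<open>auto simp: mean\<close>)
    finally show ?thesis using \<mu>0 by (simp add: ennreal_of_nat_eq_real_of_nat ennreal_mult')
  qed
  assume ab: "a \<le> b"
  have "(\<integral>\<^sup>+\<omega>. ennreal (real (\<Sum>i=1..a. X i \<omega>) * real (\<Sum>j=1..b. X j \<omega>)) \<partial>M) =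
     (\<integral>\<^sup>+\<omega>. (\<Sum>i=1..a. \<Sum>j=1..b. ennreal (real (X i \<omega>) * real (X j \<omega>))) \<partial>M)"
    by (simp add: sum_ennreal sum_nonneg sum_product)
  also have "\<dots> = (\<Sum>i=1..a. \<Sum>j=1..b. \<integral>\<^sup>+\<omega>. ennreal (real (X i \<omega>) * real (X j \<omega>)) \<partial>M)"
  proof -
    have "(\<lambda>\<omega>. ennreal (real (X i \<omega>) * real (X j \<omega>))) \<in> borel_measurable M" if "i \<ge> 1" "j \<ge> 1" for i j
      using X[OF that(1)] X[OF that(2)] by measurable
    then show ?thesis
      by (subst nn_integral_sum nn_integral_sum, force)+ (intro sum.cong refl nn_integral_sum, simp)
  qed
  also have "\<dots> = (\<Sum>i=1..a. \<Sum>j=1..b. ennreal (\<mu>\<^sup>2 + (if i = j then \<sigma> - \<mu>\<^sup>2 else 0)))"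
    by (intro sum.cong refl) (auto simp: square prod)
  also have "\<dots> = ennreal (\<Sum>i=1..a. \<Sum>j=1..b. \<mu>\<^sup>2 + (if i = j then \<sigma> - \<mu>\<^sup>2 else 0))"
    using \<sigma>0 by (simp add: sum_ennreal sum_nonneg)
  also have "(\<Sum>i=1..a. \<Sum>j=1..b. \<mu>\<^sup>2 + (if i = j then \<sigma> - \<mu>\<^sup>2 else 0)) = (\<Sum>i=1..a. real b * \<mu>\<^sup>2 + (\<sigma> - \<mu>\<^sup>2))"
    using ab by (intro sum.cong refl) (auto simp: sum.distrib)
  also have "\<dots> = real a * (\<sigma> - \<mu>\<^sup>2) + real a * real b * \<mu>\<^sup>2" by (simp add: algebra_simps)
  finally show "(\<integral>\<^sup>+\<omega>. ennreal (real (\<Sum>i=1..a. X i \<omega>) * real (\<Sum>j=1..b. X j \<omega>)) \<partial>M) =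
      ennreal (real a * (\<sigma> - \<mu>\<^sup>2) + real a * real b * \<mu>\<^sup>2)" .
qed

text \<open>
  As a function of a path and of a sequence of jumps, the random sum is measurable because the
  number of its terms takes only countably many values.
\<close>

lemma measurable_random_sum:
  fixes t :: real
  assumes "0 \<le> t"
  shows "(\<lambda>p. real (\<Sum>i=1..(fst p t). snd p i)) \<in>
    borel_measurable (PiM {0..} (\<lambda>_. count_space (UNIV :: nat set)) \<Otimes>\<^sub>M PiM {1..} (\<lambda>_. count_space (UNIV :: nat set)))"
proof (rule measurable_compose_countable[where f="\<lambda>a p. real (\<Sum>i=1..a. snd p i)"])
  fix a :: nat
  have "(\<lambda>p. real (snd p i)) \<in>
    borel_measurable (PiM {0::real..} (\<lambda>_. count_space (UNIV :: nat set)) \<Otimes>\<^sub>M PiM {1..} (\<lambda>_. count_space (UNIV :: nat set)))"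
    if "i \<in> {1..a}" for i
    by (rule measurable_compose[OF measurable_compose[OF measurable_snd measurable_component_singleton]]) (use that in auto)
  then have "(\<lambda>p. \<Sum>i=1..a. real (snd p i)) \<in>
    borel_measurable (PiM {0::real..} (\<lambda>_. count_space (UNIV :: nat set)) \<Otimes>\<^sub>M PiM {1..} (\<lambda>_. count_space (UNIV :: nat set)))"
    by (rule borel_measurable_sum)
  then show "(\<lambda>p. real (\<Sum>i=1..a. snd p i)) \<in>
    borel_measurable (PiM {0::real..} (\<lambda>_. count_space (UNIV :: nat set)) \<Otimes>\<^sub>M PiM {1..} (\<lambda>_. count_space (UNIV :: nat set)))"
    by simp
  show "(\<lambda>p. fst p t) \<in> measurable (PiM {0..} (\<lambda>_. count_space (UNIV :: nat set)) \<Otimes>\<^sub>M PiM {1::nat..} (\<lambda>_. count_space (UNIV :: nat set))) (count_space UNIV)"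
    by (rule measurable_compose[OF measurable_fst measurable_component_singleton]) (use assms in auto)
qed

text \<open>
  Freezing the underlying Poisson process \<open>P\<close> and averaging over the jumps leaves
  \<open>\<mu> P s\<close> and \<open>(\<sigma> - \<mu>\<^sup>2) P s + \<mu>\<^sup>2 P s P t\<close>, whose expectations are moments of \<open>P\<close>. The intensity
  \<open>k l\<close> of \<open>P\<close> cancels the normalisation \<open>1 / k\<close> of the jump law, and the plain power sums of
  \<open>1, \<dots>, k\<close> remain.
\<close>

lemma (in prob_space) poisson_order_moments:
  assumes N: "poisson_process_of_order M k l N" and k: "k \<ge> 1" and l: "0 < l" and s: "0 \<le> s" "s \<le> t"
  defines "m \<equiv> l * (\<Sum>i=1..k. real i)" and "v \<equiv> l * (\<Sum>i=1..k. (real i)\<^sup>2)"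
  shows "(\<integral>\<^sup>+\<omega>. ennreal (real (N s \<omega>)) \<partial>M) = ennreal (m * s)"
    and "(\<integral>\<^sup>+\<omega>. ennreal (real (N s \<omega>) * real (N t \<omega>)) \<partial>M) = ennreal (v * s + m\<^sup>2 * s * t)"
proof -
  from N obtain P X where P: "poisson_process M (real k * l) P"
    and X: "indep_vars (\<lambda>_. count_space UNIV) X {1..}"
    and unif: "\<And>i m. i \<ge> 1 \<Longrightarrow> m \<in> {1..k} \<Longrightarrow> prob {\<omega>\<in>space M. X i \<omega> = m} = 1 / real k"
    and PX: "independent_processes M {0..} (count_space UNIV) P {1..} (count_space UNIV) X"
    and eq: "\<And>t \<omega>. t \<ge> 0 \<Longrightarrow> \<omega> \<in> space M \<Longrightarrow> N t \<omega> = (\<Sum>i=1..P t \<omega>. X i \<omega>)"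
    unfolding poisson_process_of_order_def by blast
  define c where "c = real k * l"
  define \<mu> where "\<mu> = (\<Sum>m=1..k. real m) / real k"
  define \<sigma> where "\<sigma> = (\<Sum>m=1..k. (real m)\<^sup>2) / real k"
  have c: "0 < c" using k l by (simp add: c_def)
  have P: "poisson_process M c P" using P by (simp add: c_def)
  have m: "m = c * \<mu>" and v: "v = c * \<sigma>" using k by (simp_all add: m_def v_def c_def \<mu>_def \<sigma>_def)
  have \<mu>0: "0 \<le> \<mu>" and \<sigma>0: "0 \<le> \<sigma>" by (simp_all add: \<mu>_def \<sigma>_def sum_nonneg)
  have "(\<Sum>m=1..k. real m)\<^sup>2 \<le> (\<Sum>m=1..k. (real m)\<^sup>2) * real (card {1..k})"
    by (rule sum_squared_le_sum_of_squares)
  then have "(\<Sum>m=1..k. real m)\<^sup>2 / (real k)\<^sup>2 \<le> (\<Sum>m=1..k. (real m)\<^sup>2) * real k / (real k)\<^sup>2"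
    by (intro divide_right_mono) auto
  \<comment> \<open>Nonnegativity of the jump variance is needed to split integrals of extended nonnegative
    functions.\<close>
  then have \<mu>\<sigma>: "\<mu>\<^sup>2 \<le> \<sigma>" using k by (simp add: \<mu>_def \<sigma>_def power_divide power2_eq_square)
  let ?A = "PiM {0::real..} (\<lambda>_. count_space (UNIV :: nat set))"
  let ?B = "PiM {1::nat..} (\<lambda>_. count_space (UNIV :: nat set))"
  let ?P = "\<lambda>\<omega>. \<lambda>i\<in>{0..}. P i \<omega>" and ?X = "\<lambda>\<omega>. \<lambda>j\<in>{1..}. X j \<omega>"
  note indep = PX[unfolded independent_processes_def Let_def]
  have restr: "real (\<Sum>i=1..a. ?X \<omega> i) = real (\<Sum>i=1..a. X i \<omega>)" for a \<omega>
    by simp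
  have P_meas: "P u \<in> measurable M (count_space UNIV)" if "0 \<le> u" for u
    using P that by (auto simp: poisson_process_def)
  note [measurable] = P_meas[OF s(1)] P_meas[of t]
  have "(\<integral>\<^sup>+\<omega>. ennreal (real (N s \<omega>)) \<partial>M) =
    (\<integral>\<^sup>+\<omega>. (\<lambda>p. ennreal (real (\<Sum>i=1..fst p s. snd p i))) (?P \<omega>, ?X \<omega>) \<partial>M)"
    by (rule nn_integral_cong) (use s in \<open>simp add: eq\<close>)
  also have "\<dots> = (\<integral>\<^sup>+\<omega>. (\<integral>\<^sup>+\<omega>'. (\<lambda>p. ennreal (real (\<Sum>i=1..fst p s. snd p i))) (?P \<omega>, ?X \<omega>') \<partial>M) \<partial>M)"
  proof (rule nn_integral_indep_set(2)[of _ ?A _ ?B])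
    show "(\<lambda>p. ennreal (real (\<Sum>i=1..fst p s. snd p i))) \<in> borel_measurable (?A \<Otimes>\<^sub>M ?B)"
      by (intro measurable_compose[OF _ measurable_ennreal] measurable_random_sum s)
  qed (use indep in blast)+
  also have "\<dots> = (\<integral>\<^sup>+\<omega>. ennreal (real (P s \<omega>) * \<mu>) \<partial>M)"
    using s uniform_jump_sums(1)[OF X k unif] by (simp add: \<mu>_def)
  also have "\<dots> = (\<integral>\<^sup>+\<omega>. ennreal (real (P s \<omega>)) * ennreal \<mu> \<partial>M)"
    by (simp add: ennreal_mult')
  also have "\<dots> = ennreal (c * s) * ennreal \<mu>"
    using poisson_process_moments(1)[OF P c s] by (simp add: nn_integral_multc)
  finally show "(\<integral>\<^sup>+\<omega>. ennreal (real (N s \<omega>)) \<partial>M) = ennreal (m * s)"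
    using c s \<mu>0 by (simp add: m ennreal_mult'[symmetric] ac_simps)
  have "(\<integral>\<^sup>+\<omega>. ennreal (real (N s \<omega>) * real (N t \<omega>)) \<partial>M) =
    (\<integral>\<^sup>+\<omega>. (\<lambda>p. ennreal (real (\<Sum>i=1..fst p s. snd p i) * real (\<Sum>i=1..fst p t. snd p i))) (?P \<omega>, ?X \<omega>) \<partial>M)"
    by (rule nn_integral_cong) (use s in \<open>simp add: eq\<close>)
  also have "\<dots> = (\<integral>\<^sup>+\<omega>. (\<integral>\<^sup>+\<omega>'. (\<lambda>p. ennreal (real (\<Sum>i=1..fst p s. snd p i) * real (\<Sum>i=1..fst p t. snd p i))) (?P \<omega>, ?X \<omega>') \<partial>M) \<partial>M)"
  proof (rule nn_integral_indep_set(2)[of _ ?A _ ?B])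
    show "(\<lambda>p. ennreal (real (\<Sum>i=1..fst p s. snd p i) * real (\<Sum>i=1..fst p t. snd p i))) \<in> borel_measurable (?A \<Otimes>\<^sub>M ?B)"
      by (intro measurable_compose[OF _ measurable_ennreal] borel_measurable_times measurable_random_sum)
         (use s in auto)
  qed (use indep in blast)+
  also have "\<dots> = (\<integral>\<^sup>+\<omega>. ennreal (real (P s \<omega>) * (\<sigma> - \<mu>\<^sup>2) + real (P s \<omega>) * real (P t \<omega>) * \<mu>\<^sup>2) \<partial>M)"
  proof (intro nn_integral_cong_AE)
    show "AE \<omega> in M. (\<integral>\<^sup>+\<omega>'. (\<lambda>p. ennreal (real (\<Sum>i=1..fst p s. snd p i) * real (\<Sum>i=1..fst p t. snd p i))) (?P \<omega>, ?X \<omega>') \<partial>M) =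
      ennreal (real (P s \<omega>) * (\<sigma> - \<mu>\<^sup>2) + real (P s \<omega>) * real (P t \<omega>) * \<mu>\<^sup>2)"
      using poisson_process_mono[OF P c s]
    proof eventually_elim
      case (elim \<omega>)
      show ?case using uniform_jump_sums(2)[OF X k unif elim] s by (simp add: \<mu>_def \<sigma>_def)
    qed
  qed
  also have "\<dots> = (\<integral>\<^sup>+\<omega>. ennreal (real (P s \<omega>)) * ennreal (\<sigma> - \<mu>\<^sup>2) + ennreal (real (P s \<omega>) * real (P t \<omega>)) * ennreal (\<mu>\<^sup>2) \<partial>M)"
    using \<mu>\<sigma> by (intro nn_integral_cong) (simp add: ennreal_mult')
  also have "\<dots> = ennreal (c * s) * ennreal (\<sigma> - \<mu>\<^sup>2) + ennreal (c * s + c\<^sup>2 * s * t) * ennreal (\<mu>\<^sup>2)"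
    using poisson_process_moments[OF P c s] s by (simp add: nn_integral_add nn_integral_multc)
  also have "\<dots> = ennreal (c * s * (\<sigma> - \<mu>\<^sup>2) + (c * s + c\<^sup>2 * s * t) * \<mu>\<^sup>2)"
    using c s \<mu>\<sigma> by (simp add: ennreal_mult')
  also have "c * s * (\<sigma> - \<mu>\<^sup>2) + (c * s + c\<^sup>2 * s * t) * \<mu>\<^sup>2 = v * s + m\<^sup>2 * s * t"
    by (simp add: v m power2_eq_square algebra_simps)
  finally show "(\<integral>\<^sup>+\<omega>. ennreal (real (N s \<omega>) * real (N t \<omega>)) \<partial>M) = ennreal (v * s + m\<^sup>2 * s * t)" .
qed

section \<open>Independent random time change\<close>

text \<open>
  The natural numbers are discrete, so a right-continuous counting path is constant immediately to
  the right of every time, and then so is the sum of the jumps.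
\<close>

lemma (in prob_space) poisson_order_right_continuous:
  assumes N: "poisson_process_of_order M k l N" and t: "0 \<le> t" and \<omega>: "\<omega> \<in> space M"
  shows "((\<lambda>u. real (N u \<omega>)) \<longlongrightarrow> real (N t \<omega>)) (at_right t)"
proof -
  from N obtain P X where P: "poisson_process M (real k * l) P"
    and eq: "\<And>t \<omega>. t \<ge> 0 \<Longrightarrow> \<omega> \<in> space M \<Longrightarrow> N t \<omega> = (\<Sum>i=1..P t \<omega>. X i \<omega> :: nat)"
    unfolding poisson_process_of_order_def by blast
  have "((\<lambda>u. P u \<omega>) \<longlongrightarrow> P t \<omega>) (at_right t)"
    using P t \<omega> by (auto simp: poisson_process_def cadlag_def)
  then have "\<forall>\<^sub>F u in at_right t. P u \<omega> = P t \<omega>" by (simp add: tendsto_discrete)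
  moreover have "\<forall>\<^sub>F u in at_right t. t < u" by (simp add: eventually_at_right_less)
  ultimately have "\<forall>\<^sub>F u in at_right t. real (N u \<omega>) = real (N t \<omega>)"
    by eventually_elim (use t \<omega> in \<open>simp add: eq\<close>)
  then show ?thesis by (rule tendsto_eventually)
qed

text \<open>
  Evaluation of a path at a random time is not measurable for the product sigma-algebra over the
  uncountable index set \<open>{0..}\<close>. Right-continuity repairs this on the underlying space itself: with
  respect to the sigma-algebra generated by \<open>N\<close>, the map \<open>(u, \<omega>) \<mapsto> N u \<omega>\<close> is jointly measurable.
  Regarding the identity of the underlying space as a random element with values in that smaller
  measurable space, it is independent of \<open>(Y s, Y t)\<close>, and the clock can be frozen.
\<close>

lemma (in prob_space) subordinated_process:
  fixes N :: "real \<Rightarrow> 'a \<Rightarrow> nat" and Y :: "real \<Rightarrow> 'a \<Rightarrow> real"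
  assumes NY: "independent_processes M {0..} (count_space UNIV) N {0..} borel Y"
    and right: "\<And>t \<omega>. 0 \<le> t \<Longrightarrow> \<omega> \<in> space M \<Longrightarrow> ((\<lambda>u. real (N u \<omega>)) \<longlongrightarrow> real (N t \<omega>)) (at_right t)"
    and Y0: "\<And>t \<omega>. 0 \<le> t \<Longrightarrow> \<omega> \<in> space M \<Longrightarrow> 0 \<le> Y t \<omega>"
    and s: "0 \<le> s" and t: "0 \<le> t"
    and \<phi>: "\<phi> \<in> borel_measurable (borel \<Otimes>\<^sub>M borel)"
  shows "(\<lambda>\<omega>. real (N (Y t \<omega>) \<omega>)) \<in> borel_measurable M"
    and "(\<integral>\<^sup>+\<omega>. \<phi> (real (N (Y s \<omega>) \<omega>), real (N (Y t \<omega>) \<omega>)) \<partial>M) =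
      (\<integral>\<^sup>+\<omega>. (\<integral>\<^sup>+\<omega>'. \<phi> (real (N (Y s \<omega>) \<omega>'), real (N (Y t \<omega>) \<omega>')) \<partial>M) \<partial>M)"
proof -
  let ?A = "PiM {0::real..} (\<lambda>_. count_space (UNIV :: nat set))"
  let ?B = "PiM {0::real..} (\<lambda>_. borel :: real measure)"
  define p where "p \<omega> = (\<lambda>i\<in>{0..}. N i \<omega>)" for \<omega>
  define q where "q \<omega> = (\<lambda>i\<in>{0..}. Y i \<omega>)" for \<omega>
  have p: "p \<in> measurable M ?A" and q: "q \<in> measurable M ?B"
    and ind: "indep_set {p -` S \<inter> space M | S. S \<in> sets ?A} {q -` T \<inter> space M | T. T \<in> sets ?B}"
    using NY unfolding independent_processes_def Let_def p_def[abs_def] q_def[abs_def] by blast+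
  \<comment> \<open>The sigma-algebra generated by \<open>N\<close>.\<close>
  define S where "S = vimage_algebra (space M) p ?A"
  have p_space: "p \<in> space M \<rightarrow> space ?A" using measurable_space[OF p] by auto
  have space_S[simp]: "space S = space M" by (simp add: S_def)
  have sets_S: "sets S = {p -` A \<inter> space M | A. A \<in> sets ?A}"
    unfolding S_def by (rule sets_vimage_algebra2) (rule p_space)
  have id_S: "(\<lambda>\<omega>. \<omega>) \<in> measurable M S"
    unfolding S_def by (rule measurable_vimage_algebra2) (use p in auto)
  have "(\<lambda>\<omega>. real (N u \<omega>)) \<in> borel_measurable S" if "0 \<le> u" for u
  proof -
    have "(\<lambda>\<omega>. real (p \<omega> u)) \<in> borel_measurable S"
      unfolding S_def
      by (rule measurable_compose[OF measurable_compose[OF measurable_vimage_algebra1[OF p_space] measurable_component_singleton]])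
        (use that in auto)
    then show ?thesis using that by (simp add: p_def)
  qed
  then have joint: "(\<lambda>(u, \<omega>). real (N (max u 0) \<omega>)) \<in> borel_measurable (borel \<Otimes>\<^sub>M S)"
    by (rule measurable_right_continuous_process) (auto intro: right)
  have Y: "Y u \<in> borel_measurable M" if "0 \<le> u" for u
  proof -
    have "(\<lambda>\<omega>. q \<omega> u) \<in> borel_measurable M"
      by (rule measurable_compose[OF q measurable_component_singleton]) (use that in auto)
    then show ?thesis using that by (simp add: q_def)
  qed
  have "(\<lambda>\<omega>. (\<lambda>(u, \<omega>). real (N (max u 0) \<omega>)) (Y t \<omega>, \<omega>)) \<in> borel_measurable M"
    by (rule measurable_compose[OF measurable_Pair[OF Y[OF t] id_S] joint])
  then show "(\<lambda>\<omega>. real (N (Y t \<omega>) \<omega>)) \<in> borel_measurable M"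
    by (subst (asm) measurable_cong[of _ _ "\<lambda>\<omega>. real (N (Y t \<omega>) \<omega>)"]) (simp_all add: max_absorb1 Y0[OF t])
  \<comment> \<open>Times are truncated at \<open>0\<close> only for joint measurability; \<open>Y\<close> takes nonnegative values.\<close>
  define h where "h x = \<phi> (real (N (max (fst (snd x)) 0) (fst x)), real (N (max (snd (snd x)) 0) (fst x)))" for x
  have h: "h \<in> borel_measurable (S \<Otimes>\<^sub>M (borel \<Otimes>\<^sub>M borel))"
  proof -
    have "(\<lambda>x. \<phi> ((\<lambda>(u, \<omega>). real (N (max u 0) \<omega>)) (fst (snd x), fst x), (\<lambda>(u, \<omega>). real (N (max u 0) \<omega>)) (snd (snd x), fst x)))
        \<in> borel_measurable (S \<Otimes>\<^sub>M (borel \<Otimes>\<^sub>M borel))"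
      by (intro measurable_compose[OF _ \<phi>] measurable_compose[OF _ joint] measurable_Pair
        measurable_compose[OF measurable_snd measurable_fst] measurable_compose[OF measurable_snd measurable_snd] measurable_fst)
    then show ?thesis unfolding h_def[abs_def] by simp
  qed
  have ind': "indep_set {(\<lambda>\<omega>. \<omega>) -` A \<inter> space M | A. A \<in> sets S}
      {(\<lambda>\<omega>. (Y s \<omega>, Y t \<omega>)) -` T \<inter> space M | T. T \<in> sets (borel \<Otimes>\<^sub>M borel)}"
  proof -
    have "{(\<lambda>\<omega>. \<omega>) -` A \<inter> space M | A. A \<in> sets S} \<subseteq> {p -` S \<inter> space M | S. S \<in> sets ?A}"
      unfolding sets_S by auto
    moreover have "{(\<lambda>\<omega>. (Y s \<omega>, Y t \<omega>)) -` T \<inter> space M | T. T \<in> sets (borel \<Otimes>\<^sub>M borel)}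
        \<subseteq> {q -` T \<inter> space M | T. T \<in> sets ?B}"
    proof safe
      fix T :: "(real \<times> real) set" assume T: "T \<in> sets (borel \<Otimes>\<^sub>M borel)"
      have "(\<lambda>f. (f s, f t)) \<in> measurable ?B (borel \<Otimes>\<^sub>M borel)"
        using s t by (intro measurable_Pair measurable_component_singleton) auto
      then have "(\<lambda>f. (f s, f t)) -` T \<inter> space ?B \<in> sets ?B" using T by (rule measurable_sets)
      moreover have "(\<lambda>\<omega>. (Y s \<omega>, Y t \<omega>)) -` T \<inter> space M = q -` ((\<lambda>f. (f s, f t)) -` T \<inter> space ?B) \<inter> space M"
        using s t measurable_space[OF q] by (auto simp: q_def)
      ultimately show "\<exists>T'. (\<lambda>\<omega>. (Y s \<omega>, Y t \<omega>)) -` T \<inter> space M = q -` T' \<inter> space M \<and> T' \<in> sets ?B"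
        by blast
    qed
    ultimately show ?thesis by (rule indep_set_mono[OF ind])
  qed
  have h_eq: "h (\<omega>', Y s \<omega>, Y t \<omega>) = \<phi> (real (N (Y s \<omega>) \<omega>'), real (N (Y t \<omega>) \<omega>'))" if "\<omega> \<in> space M" for \<omega> \<omega>'
    using Y0[OF s that] Y0[OF t that] by (simp add: h_def max_absorb1)
  have "(\<integral>\<^sup>+\<omega>. \<phi> (real (N (Y s \<omega>) \<omega>), real (N (Y t \<omega>) \<omega>)) \<partial>M) = (\<integral>\<^sup>+\<omega>. h (\<omega>, Y s \<omega>, Y t \<omega>) \<partial>M)"
    by (rule nn_integral_cong) (rule h_eq[symmetric])
  also have "\<dots> = (\<integral>\<^sup>+\<omega>. (\<integral>\<^sup>+\<omega>'. h (\<omega>', Y s \<omega>, Y t \<omega>) \<partial>M) \<partial>M)"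
    by (rule nn_integral_indep_set(1)[OF id_S measurable_Pair[OF Y[OF s] Y[OF t]] ind' h])
  also have "\<dots> = (\<integral>\<^sup>+\<omega>. (\<integral>\<^sup>+\<omega>'. \<phi> (real (N (Y s \<omega>) \<omega>'), real (N (Y t \<omega>) \<omega>')) \<partial>M) \<partial>M)"
    by (intro nn_integral_cong h_eq)
  finally show "(\<integral>\<^sup>+\<omega>. \<phi> (real (N (Y s \<omega>) \<omega>), real (N (Y t \<omega>) \<omega>)) \<partial>M) =
      (\<integral>\<^sup>+\<omega>. (\<integral>\<^sup>+\<omega>'. \<phi> (real (N (Y s \<omega>) \<omega>'), real (N (Y t \<omega>) \<omega>')) \<partial>M) \<partial>M)" .
qed

section \<open>Uniqueness of Laplace transforms\<close>

text \<open>
  For a law on \<open>[-1, 1]\<close> the Taylor polynomials of the characteristic function, with the moments as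
  coefficients, converge to the characteristic function; hence the moments determine it, and with it
  the law.
\<close>

lemma real_distribution_eq_if_moments_eq:
  assumes P: "real_distribution P" and Q: "real_distribution Q"
    and bP: "AE x in P. \<bar>x\<bar> \<le> 1" and bQ: "AE x in Q. \<bar>x\<bar> \<le> 1"
    and eq: "\<And>n. (LINT x|P. x ^ n) = (LINT x|Q. x ^ n)"
  shows "P = Q"
proof (rule Levy_uniqueness[OF P Q], rule ext)
  fix t :: real
  define S where "S n = (\<Sum>k\<le>n. ((\<i> * t) ^ k / fact k) * (LINT x|P. x ^ k))" for n
  have lim: "S \<longlonglongrightarrow> char R t"
    if R: "real_distribution R" "AE x in R. \<bar>x\<bar> \<le> 1" "\<And>n. (LINT x|P. x ^ n) = (LINT x|R. x ^ n)" for R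
  proof -
    interpret R: real_distribution R by fact
    have int: "integrable R (\<lambda>x. x ^ k)" for k
      by (rule R.integrable_const_bound[where B=1])
         (use R(2) in \<open>auto elim!: eventually_mono simp: power_abs power_le_one\<close>)
    have "norm (S n - char R t) \<le> 2 * (\<bar>t\<bar> ^ n / fact n)" for n
    proof -
      have "(LINT x|R. \<bar>x\<bar> ^ n) \<le> (LINT x|R. 1)"
        by (rule integral_mono_AE)
           (use R(2) integrable_abs[OF int[of n]] in \<open>auto elim!: eventually_mono simp: power_abs power_le_one\<close>)
      then have le1: "(LINT x|R. \<bar>x\<bar> ^ n) \<le> 1" using R.prob_space by simp
      have "norm (S n - char R t) = norm (char R t - (\<Sum>k\<le>n. ((\<i> * t) ^ k / fact k) * (LINT x|R. x ^ k)))"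
        by (simp add: S_def R(3) norm_minus_commute)
      also have "\<dots> \<le> (2 * \<bar>t\<bar> ^ n / fact n) * (LINT x|R. \<bar>x\<bar> ^ n)"
        by (rule R.char_approx1) (rule int)
      also have "\<dots> \<le> (2 * \<bar>t\<bar> ^ n / fact n) * 1"
        by (rule mult_left_mono[OF le1]) simp
      finally show ?thesis by simp
    qed
    then have "\<forall>\<^sub>F n in sequentially. norm (S n - char R t) \<le> 2 * (\<bar>t\<bar> ^ n / fact n)"
      by (intro always_eventually allI)
    moreover have "(\<lambda>n. \<bar>t\<bar> ^ n / fact n) \<longlonglongrightarrow> 0"
      using summable_LIMSEQ_zero[OF summable_exp[of "\<bar>t\<bar>"]] by (simp only: divide_inverse_commute)
    then have "(\<lambda>n. 2 * (\<bar>t\<bar> ^ n / fact n)) \<longlonglongrightarrow> 0"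
      by (rule tendsto_mult_right_zero)
    ultimately have "(\<lambda>n. S n - char R t) \<longlonglongrightarrow> 0"
      by (rule Lim_null_comparison)
    then show ?thesis by (simp add: LIM_zero_iff)
  qed
  show "char P t = char Q t"
    by (rule LIMSEQ_unique[OF lim[OF P bP refl] lim[OF Q bQ eq]])
qed

text \<open>
  Under \<open>x \<mapsto> exp (- x)\<close> a law on \<open>[0, \<infinity>)\<close> becomes a law on \<open>[0, 1]\<close> whose \<open>n\<close>-th moment is the value of
  the Laplace transform at \<open>n\<close>. The logarithm recovers the original law.
\<close>

lemma real_distribution_eq_if_laplace_eq:
  assumes P: "real_distribution P" and Q: "real_distribution Q"
    and nP: "AE x in P. 0 \<le> x" and nQ: "AE x in Q. 0 \<le> x"
    and eq: "\<And>n. (\<integral>\<^sup>+x. ennreal (exp (- real n * x)) \<partial>P) = (\<integral>\<^sup>+x. ennreal (exp (- real n * x)) \<partial>Q)"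
  shows "P = Q"
proof -
  interpret P: real_distribution P by fact
  interpret Q: real_distribution Q by fact
  let ?e = "\<lambda>R. distr R borel (\<lambda>x::real. exp (- x))"
  have moment: "(LINT x|?e R. x ^ n) = enn2real (\<integral>\<^sup>+x. ennreal (exp (- real n * x)) \<partial>R)"
    if [simp, measurable_cong]: "sets R = sets borel" for R n
    by (simp add: integral_distr integral_eq_nn_integral exp_of_nat_mult[symmetric])
  have "?e P = ?e Q"
  proof (rule real_distribution_eq_if_moments_eq)
    show "real_distribution (?e P)" "real_distribution (?e Q)"
      unfolding real_distribution_def real_distribution_axioms_def
      by (auto intro!: P.prob_space_distr Q.prob_space_distr)
    show "AE x in ?e P. \<bar>x\<bar> \<le> 1" "AE x in ?e Q. \<bar>x\<bar> \<le> 1"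
      using nP nQ by (auto simp: AE_distr_iff)
    show "(LINT x|?e P. x ^ n) = (LINT x|?e Q. x ^ n)" for n
      using eq[of n] by (simp add: moment)
  qed
  moreover have "distr (?e R) borel (\<lambda>y. - ln y) = R"
    if [simp, measurable_cong]: "sets R = sets borel" for R
    by (simp add: distr_distr comp_def distr_id2)
  ultimately show ?thesis by (metis P.events_eq_borel Q.events_eq_borel)
qed

lemma nn_integral_exp_Ici:
  fixes c :: real
  assumes "0 < c"
  shows "(\<integral>\<^sup>+a. ennreal (exp (- a * c)) * indicator {0..} a \<partial>lborel) = ennreal (1 / c)"
proof -
  have "(\<integral>\<^sup>+a. ennreal (exp (- a * c)) * indicator {0..} a \<partial>lborel) =
     ennreal \<bar>1 / c\<bar> * (\<integral>\<^sup>+a. ennreal (a ^ 0 * exp (- a)) * indicator {0..} a \<partial>lborel)"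
    using assms
    by (subst nn_integral_real_affine[where c="1 / c" and t=0])
       (auto intro!: nn_integral_cong arg_cong2[where f="(*)"] simp: indicator_def field_simps)
  then show ?thesis using assms by (simp only: nn_intergal_power_times_exp_Ici) simp
qed

text \<open>
  Euler's integral, rescaled by \<open>c\<close>. The value \<open>c\<^sup>-\<^sup>\<alpha>\<close> will turn up again as the Laplace
  transform of the potential measure of the \<open>\<alpha>\<close>-stable subordinator.
\<close>

lemma nn_integral_gamma_exp:
  fixes c :: real
  assumes \<alpha>: "0 < \<alpha>" and c: "0 < c"
  shows "(\<integral>\<^sup>+x. ennreal (exp (- c * x)) * ennreal (indicator {0..} x * x powr (\<alpha> - 1) / Gamma \<alpha>) \<partial>lborel) = ennreal (c powr - \<alpha>)"
proof -
  have G: "0 < Gamma \<alpha>" using \<alpha> by (rule Gamma_real_pos)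
  have "(\<integral>\<^sup>+x. ennreal (exp (- c * x)) * ennreal (indicator {0..} x * x powr (\<alpha> - 1) / Gamma \<alpha>) \<partial>lborel) =
     ennreal \<bar>1 / c\<bar> * (\<integral>\<^sup>+x. ennreal (exp (- x)) * ennreal (indicator {0..} (x / c) * (x / c) powr (\<alpha> - 1) / Gamma \<alpha>) \<partial>lborel)"
    using c by (subst nn_integral_real_affine[where c="1 / c" and t=0]) simp_all
  also have "\<dots> = ennreal (1 / c) * (\<integral>\<^sup>+x. ennreal (c powr (1 - \<alpha>) / Gamma \<alpha>) * ennreal (indicator {0..} x * x powr (\<alpha> - 1) / exp x) \<partial>lborel)"
  proof (rule arg_cong2[where f="(*)"], goal_cases)
    case 1
    show ?case using c by simp
  next
    case 2
    show ?case
    proof (rule nn_integral_cong)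
      fix x :: real
      show "ennreal (exp (- x)) * ennreal (indicator {0..} (x / c) * (x / c) powr (\<alpha> - 1) / Gamma \<alpha>) =
        ennreal (c powr (1 - \<alpha>) / Gamma \<alpha>) * ennreal (indicator {0..} x * x powr (\<alpha> - 1) / exp x)"
      proof (cases "0 \<le> x")
        case True
        have "(x / c) powr (\<alpha> - 1) = x powr (\<alpha> - 1) * c powr (1 - \<alpha>)"
          using True c powr_minus_divide[of c "\<alpha> - 1"] by (simp add: powr_divide)
        then have "exp (- x) * ((x / c) powr (\<alpha> - 1) / Gamma \<alpha>) =
            c powr (1 - \<alpha>) / Gamma \<alpha> * (x powr (\<alpha> - 1) / exp x)"
          by (simp add: exp_minus divide_inverse ac_simps)
        moreover have "0 \<le> exp (- x)" "0 \<le> c powr (1 - \<alpha>) / Gamma \<alpha>" using G by simp_all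
        ultimately have "ennreal (exp (- x)) * ennreal ((x / c) powr (\<alpha> - 1) / Gamma \<alpha>) =
            ennreal (c powr (1 - \<alpha>) / Gamma \<alpha>) * ennreal (x powr (\<alpha> - 1) / exp x)"
          by (simp only: ennreal_mult'[symmetric])
        then show ?thesis using True c by simp
      next
        case False
        then show ?thesis using c by (simp add: divide_nonneg_pos not_le divide_less_0_iff)
      qed
    qed
  qed
  also have "\<dots> = ennreal (1 / c) * (ennreal (c powr (1 - \<alpha>) / Gamma \<alpha>) * ennreal (Gamma \<alpha>))"
    by (subst nn_integral_cmult) (simp_all add: Gamma_conv_nn_integral_real[OF \<alpha>])
  also have "\<dots> = ennreal (1 / c * (c powr (1 - \<alpha>) / Gamma \<alpha> * Gamma \<alpha>))"
  proof -
    have A: "0 \<le> 1 / c" and B: "0 \<le> c powr (1 - \<alpha>) / Gamma \<alpha>" using c G by simp_all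
    show ?thesis by (simp only: ennreal_mult'[OF A] ennreal_mult'[OF B])
  qed
  also have "1 / c * (c powr (1 - \<alpha>) / Gamma \<alpha> * Gamma \<alpha>) = c powr - \<alpha>"
    using c G by (simp add: powr_diff powr_minus field_simps)
  finally show ?thesis .
qed

section \<open>The potential measure of a stable subordinator\<close>

lemma first_passage_nonneg: "0 \<le> first_passage L t \<omega>"
  unfolding first_passage_def by (auto intro!: cInf_greatest)

text \<open>
  Among the times \<open>u \<ge> 0\<close>, the conditions \<open>L u \<omega> \<le> t\<close> and \<open>u \<le> first_passage L t \<omega>\<close> on a monotone path
  differ at most at the end point. That point is a null set for every integral over \<open>u\<close>, so it does
  not matter to which side it belongs.
\<close>

lemma first_passage_bounds:
  assumes mono: "mono_on {0..} (\<lambda>t. L t \<omega>)" and L0: "L 0 \<omega> = 0"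
    and ex: "\<exists>u>0. L u \<omega> > t" and t: "0 \<le> t" and u: "0 \<le> u"
  shows "L u \<omega> \<le> t \<Longrightarrow> u \<le> first_passage L t \<omega>"
    and "u < first_passage L t \<omega> \<Longrightarrow> L u \<omega> \<le> t"
proof -
  have fp: "first_passage L t \<omega> = Inf {u. u > 0 \<and> L u \<omega> > t}"
    using ex by (simp add: first_passage_def)
  show "u \<le> first_passage L t \<omega>" if le: "L u \<omega> \<le> t"
    unfolding fp
  proof (rule cInf_greatest)
    show "{u. u > 0 \<and> L u \<omega> > t} \<noteq> {}" using ex by auto
    fix w assume w: "w \<in> {u. u > 0 \<and> L u \<omega> > t}"
    show "u \<le> w"
    proof (rule ccontr)
      assume "\<not> u \<le> w"
      then have "L w \<omega> \<le> L u \<omega>" using w u by (intro mono_onD[OF mono]) auto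
      then show False using w le by simp
    qed
  qed
  show "L u \<omega> \<le> t" if less: "u < first_passage L t \<omega>"
  proof (rule ccontr)
    assume gt: "\<not> L u \<omega> \<le> t"
    then have "u \<noteq> 0" using L0 t by auto
    then have "u \<in> {u. u > 0 \<and> L u \<omega> > t}" using u gt by auto
    then have "Inf {u. u > 0 \<and> L u \<omega> > t} \<le> u"
      by (rule cInf_lower) (auto intro!: bdd_belowI[of _ 0])
    then show False using less fp by simp
  qed
qed

locale stable_process = prob_space M
  for M :: "'a measure" +
  fixes \<alpha> :: real and L :: "real \<Rightarrow> 'a \<Rightarrow> real"
  assumes stable: "stable_subordinator M \<alpha> L" and \<alpha>_pos: "0 < \<alpha>"
begin

lemma L_measurable: "0 \<le> t \<Longrightarrow> L t \<in> borel_measurable M"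
  using stable unfolding stable_subordinator_def subordinator_def levy_process_def by blast

lemma AE_path: "AE \<omega> in M. mono_on {0..} (\<lambda>t. L t \<omega>) \<and> L 0 \<omega> = 0"
  using stable unfolding stable_subordinator_def subordinator_def levy_process_def
  by (auto simp: AE_conj_iff)

lemma AE_nonneg:
  assumes "0 \<le> t"
  shows "AE \<omega> in M. 0 \<le> L t \<omega>"
  using AE_path
proof eventually_elim
  case (elim \<omega>)
  then have "L 0 \<omega> \<le> L t \<omega>" using assms by (intro mono_onD[of "{0..}" "\<lambda>t. L t \<omega>"]) auto
  then show ?case using elim by simp
qed

lemma joint_measurable: "(\<lambda>(u, \<omega>). L (max u 0) \<omega>) \<in> borel_measurable (lborel \<Otimes>\<^sub>M M)"
proof -
  have "(\<lambda>(u, \<omega>). L (max u 0) \<omega>) \<in> borel_measurable (borel \<Otimes>\<^sub>M M)"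
  proof (rule measurable_right_continuous_process[OF L_measurable])
    fix t :: real and \<omega> assume "0 \<le> t" "\<omega> \<in> space M"
    then show "((\<lambda>u. L u \<omega>) \<longlongrightarrow> L t \<omega>) (at_right t)"
      using stable unfolding stable_subordinator_def subordinator_def levy_process_def cadlag_def by blast
  qed
  then show ?thesis
    by (subst measurable_cong_sets[OF sets_pair_measure_cong[OF sets_lborel refl] refl])
qed

lemma measurable_L_max:
  assumes "f \<in> borel_measurable K" "g \<in> measurable K M"
  shows "(\<lambda>x. L (max (f x) 0) (g x)) \<in> borel_measurable K"
proof -
  have "(\<lambda>x. (f x, g x)) \<in> measurable K (lborel \<Otimes>\<^sub>M M)"
    using assms by (intro measurable_Pair) auto
  from measurable_compose[OF this joint_measurable] show ?thesis by simp
qed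

lemma nn_laplace:
  assumes t: "0 \<le> t" and s: "0 \<le> s"
  shows "(\<integral>\<^sup>+\<omega>. ennreal (exp (- s * L t \<omega>)) \<partial>M) = ennreal (exp (- t * s powr \<alpha>))"
proof -
  have "integrable M (\<lambda>\<omega>. exp (- s * L t \<omega>))"
  proof (rule integrable_const_bound[where B=1])
    show "AE \<omega> in M. norm (exp (- s * L t \<omega>)) \<le> 1"
      using AE_nonneg[OF t] by eventually_elim (use s in simp)
  qed (use L_measurable[OF t] in measurable)
  then have "(\<integral>\<^sup>+\<omega>. ennreal (exp (- s * L t \<omega>)) \<partial>M) = ennreal (LINT \<omega>|M. exp (- s * L t \<omega>))"
    by (rule nn_integral_eq_integral) simp
  moreover have "(LINT \<omega>|M. exp (- s * L t \<omega>)) = exp (- t * s powr \<alpha>)"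
    using stable t s unfolding stable_subordinator_def by blast
  ultimately show ?thesis by simp
qed

text \<open>
  Chernoff's bound: \<open>P (L n \<le> t) \<le> exp t * E[exp (- L n)] = exp (t - n)\<close>.
\<close>

lemma AE_unbounded: "AE \<omega> in M. \<exists>u>0. L u \<omega> > t"
proof -
  have bound: "prob {\<omega>\<in>space M. L (real n) \<omega> \<le> t} \<le> exp t * exp (- real n)" for n
  proof -
    have [measurable]: "L (real n) \<in> borel_measurable M" by (rule L_measurable) simp
    have "emeasure M {\<omega>\<in>space M. L (real n) \<omega> \<le> t} = (\<integral>\<^sup>+\<omega>. indicator {\<omega>\<in>space M. L (real n) \<omega> \<le> t} \<omega> \<partial>M)"
      by (rule nn_integral_indicator[symmetric]) measurable
    also have "\<dots> \<le> (\<integral>\<^sup>+\<omega>. ennreal (exp t) * ennreal (exp (- 1 * L (real n) \<omega>)) \<partial>M)"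
    proof (rule nn_integral_mono)
      fix \<omega>
      have "1 \<le> ennreal (exp t) * ennreal (exp (- 1 * L (real n) \<omega>))" if "L (real n) \<omega> \<le> t"
      proof -
        have "1 \<le> exp t * exp (- 1 * L (real n) \<omega>)"
          using that by (simp add: mult_exp_exp)
        then have "ennreal 1 \<le> ennreal (exp t * exp (- 1 * L (real n) \<omega>))" by (rule ennreal_leI)
        then show ?thesis by (simp add: ennreal_mult')
      qed
      then show "indicator {\<omega>\<in>space M. L (real n) \<omega> \<le> t} \<omega> \<le> ennreal (exp t) * ennreal (exp (- 1 * L (real n) \<omega>))"
        by (simp add: indicator_def)
    qed
    also have "\<dots> = ennreal (exp t) * (\<integral>\<^sup>+\<omega>. ennreal (exp (- 1 * L (real n) \<omega>)) \<partial>M)"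
      by (rule nn_integral_cmult) measurable
    also have "\<dots> = ennreal (exp t * exp (- real n))"
      using nn_laplace[of "real n" 1] by (simp add: ennreal_mult')
    finally show ?thesis by (simp add: emeasure_eq_measure)
  qed
  let ?B = "\<lambda>n. {\<omega>\<in>space M. L (real (Suc n)) \<omega> \<le> t}"
  have B[measurable]: "?B n \<in> events" for n
    using L_measurable[of "real (Suc n)"] by measurable
  have "prob (\<Inter>n. ?B n) \<le> exp t * exp (- real (Suc n))" for n
    by (rule order_trans[OF finite_measure_mono bound[of "Suc n"]]) (use B in auto)
  moreover have "(\<lambda>n. exp t * exp (- real (Suc n))) \<longlonglongrightarrow> exp t * 0"
    by (intro tendsto_mult tendsto_const LIMSEQ_Suc[of "\<lambda>n. exp (- real n)"]
      filterlim_compose[OF exp_at_bot] filterlim_compose[OF filterlim_uminus_at_bot_at_top] filterlim_real_sequentially)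
  ultimately have "prob (\<Inter>n. ?B n) \<le> 0"
    by (intro LIMSEQ_le_const[of "\<lambda>n. exp t * exp (- real (Suc n))"]) auto
  then have "prob (\<Inter>n. ?B n) = 0" by (simp add: measure_le_0_iff)
  moreover have "(\<Inter>n. ?B n) \<in> events"
    by (rule sets.countable_INT) (use B in blast)+
  ultimately have "(\<Inter>n. ?B n) \<in> null_sets M"
    by (intro null_setsI) (simp_all only: emeasure_eq_measure ennreal_0)
  then have "AE \<omega> in M. \<omega> \<notin> (\<Inter>n. ?B n)" by (rule AE_not_in)
  with AE_space show ?thesis
  proof eventually_elim
    case (elim \<omega>)
    then obtain n where "t < L (real (Suc n)) \<omega>" by (auto simp: not_le)
    then show ?case by (intro exI[of _ "real (Suc n)"]) simp
  qed
qed

lemma AE_first_passage: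
  assumes t: "0 \<le> t"
  shows "AE \<omega> in M. \<forall>u\<ge>0. (L u \<omega> \<le> t \<longrightarrow> u \<le> first_passage L t \<omega>) \<and> (u < first_passage L t \<omega> \<longrightarrow> L u \<omega> \<le> t)"
  using AE_path AE_unbounded[of t]
proof eventually_elim
  case (elim \<omega>)
  then show ?case using first_passage_bounds[of L \<omega> t] t by blast
qed

lemma AE_first_passage_mono:
  assumes s: "0 \<le> s" "s \<le> t"
  shows "AE \<omega> in M. first_passage L s \<omega> \<le> first_passage L t \<omega>"
  using AE_first_passage[OF s(1)] AE_first_passage[OF order_trans[OF s]]
proof eventually_elim
  case (elim \<omega>)
  show ?case
  proof (rule ccontr)
    assume "\<not> first_passage L s \<omega> \<le> first_passage L t \<omega>"
    then obtain u where u: "first_passage L t \<omega> < u" "u < first_passage L s \<omega>"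
      using dense[of "first_passage L t \<omega>" "first_passage L s \<omega>"] by auto
    have "0 \<le> u" using u(1) first_passage_nonneg[of L t \<omega>] by simp
    then have "L u \<omega> \<le> s" using elim(1) u(2) by blast
    then have "u \<le> first_passage L t \<omega>" using elim(2) \<open>0 \<le> u\<close> s by auto
    then show False using u(1) by simp
  qed
qed

definition potential_density :: "real \<Rightarrow> real" where
  "potential_density x = indicator {0..} x * x powr (\<alpha> - 1) / Gamma \<alpha>"

lemma potential_density_measurable[measurable]: "potential_density \<in> borel_measurable borel"
  unfolding potential_density_def by measurable

text \<open>
  The left-hand side integrates \<open>g\<close> against the potential measure \<open>U\<close> of \<open>L\<close>. Integrating the
  exponential \<open>exp (- a s\<^sup>\<alpha>)\<close> over \<open>a\<close> gives the Laplace transform \<open>s\<^sup>-\<^sup>\<alpha>\<close> of \<open>U\<close>, which is also that of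
  the density on the right. Neither measure is finite, so uniqueness of Laplace transforms is
  applied after both are multiplied by \<open>exp (- x)\<close>: this makes them probability measures, because
  \<open>s\<^sup>-\<^sup>\<alpha> = 1\<close> at \<open>s = 1\<close>, and shifts the argument of the transforms by \<open>1\<close>.
\<close>

theorem potential_measure_eq:
  assumes g: "g \<in> borel_measurable borel"
  shows "(\<integral>\<^sup>+a. (\<integral>\<^sup>+\<omega>. g (L a \<omega>) \<partial>M) * indicator {0..} a \<partial>lborel) =
     (\<integral>\<^sup>+x. g x * ennreal (potential_density x) \<partial>lborel)"
proof -
  define A where "A = density lborel (indicator {0::real..})"
  define U where "U = distr (A \<Otimes>\<^sub>M M) borel (\<lambda>(a, \<omega>). L (max a 0) \<omega>)"
  have sets_A: "sets A = sets lborel" by (simp add: A_def)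
  have joint_A: "(\<lambda>(u, \<omega>). L (max u 0) \<omega>) \<in> borel_measurable (A \<Otimes>\<^sub>M M)"
    using joint_measurable by (subst measurable_cong_sets[OF sets_pair_measure_cong[OF sets_A refl] refl])
  have sets_U[measurable_cong, simp]: "sets U = sets borel" by (simp add: U_def)
  have nn_U: "(\<integral>\<^sup>+x. g x \<partial>U) = (\<integral>\<^sup>+a. (\<integral>\<^sup>+\<omega>. g (L a \<omega>) \<partial>M) * indicator {0..} a \<partial>lborel)"
    if g: "g \<in> borel_measurable borel" for g
  proof -
    have comp: "(\<lambda>p. g ((\<lambda>(u, \<omega>). L (max u 0) \<omega>) p)) \<in> borel_measurable (A \<Otimes>\<^sub>M M)"
      by (rule measurable_compose[OF joint_A g])
    have comp': "(\<lambda>p. g ((\<lambda>(u, \<omega>). L (max u 0) \<omega>) p)) \<in> borel_measurable (lborel \<Otimes>\<^sub>M M)"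
      by (rule measurable_compose[OF joint_measurable g])
    have inner: "(\<lambda>a. \<integral>\<^sup>+\<omega>. g (L (max a 0) \<omega>) \<partial>M) \<in> borel_measurable lborel"
      using borel_measurable_nn_integral_fst[OF comp'] by simp
    have "(\<integral>\<^sup>+x. g x \<partial>U) = (\<integral>\<^sup>+p. g ((\<lambda>(u, \<omega>). L (max u 0) \<omega>) p) \<partial>(A \<Otimes>\<^sub>M M))"
      unfolding U_def by (rule nn_integral_distr[OF joint_A]) (use g in simp)
    also have "\<dots> = (\<integral>\<^sup>+a. (\<integral>\<^sup>+\<omega>. g (L (max a 0) \<omega>) \<partial>M) \<partial>A)"
      using nn_integral_fst[OF comp] by simp
    also have "\<dots> = (\<integral>\<^sup>+a. indicator {0..} a * (\<integral>\<^sup>+\<omega>. g (L (max a 0) \<omega>) \<partial>M) \<partial>lborel)"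
      unfolding A_def by (rule nn_integral_density) (use inner in auto)
    also have "\<dots> = (\<integral>\<^sup>+a. (\<integral>\<^sup>+\<omega>. g (L a \<omega>) \<partial>M) * indicator {0..} a \<partial>lborel)"
      by (rule nn_integral_cong) (simp add: indicator_def max_absorb1)
    finally show ?thesis .
  qed
  have laplace_U: "(\<integral>\<^sup>+x. ennreal (exp (- s * x)) \<partial>U) = ennreal (s powr - \<alpha>)" if s: "0 < s" for s
  proof -
    have "(\<integral>\<^sup>+x. ennreal (exp (- s * x)) \<partial>U) =
        (\<integral>\<^sup>+a. (\<integral>\<^sup>+\<omega>. ennreal (exp (- s * L a \<omega>)) \<partial>M) * indicator {0..} a \<partial>lborel)"
      by (rule nn_U) measurable
    also have "\<dots> = (\<integral>\<^sup>+a. ennreal (exp (- a * s powr \<alpha>)) * indicator {0..} a \<partial>lborel)"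
      by (rule nn_integral_cong) (use s in \<open>auto simp: indicator_def nn_laplace[simplified]\<close>)
    also have "\<dots> = ennreal (1 / s powr \<alpha>)"
      by (rule nn_integral_exp_Ici) (use s in simp)
    finally show ?thesis using s by (simp add: powr_minus_divide)
  qed
  have AE_U: "AE x in U. 0 \<le> x"
  proof -
    have "emeasure U {..<0} = (\<integral>\<^sup>+x. indicator {..<0} x \<partial>U)"
      by (rule nn_integral_indicator[symmetric]) simp
    also have "\<dots> = (\<integral>\<^sup>+a. (\<integral>\<^sup>+\<omega>. indicator {..<0} (L a \<omega>) \<partial>M) * indicator {0..} a \<partial>lborel)"
      by (rule nn_U) simp
    also have "\<dots> = (\<integral>\<^sup>+a. 0 \<partial>(lborel :: real measure))"
    proof (rule nn_integral_cong)
      fix a :: real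
      have "(\<integral>\<^sup>+\<omega>. indicator {..<0} (L a \<omega>) \<partial>M) = (\<integral>\<^sup>+\<omega>. 0 \<partial>M)" if "0 \<le> a"
        by (rule nn_integral_cong_AE) (use AE_nonneg[OF that] in \<open>auto elim!: eventually_mono simp: indicator_def\<close>)
      then show "(\<integral>\<^sup>+\<omega>. indicator {..<0} (L a \<omega>) \<partial>M) * indicator {0..} a = (0::ennreal)"
        by (cases "0 \<le> a") simp_all
    qed
    finally have "{..<0} \<in> null_sets U" by (intro null_setsI) simp_all
    from AE_not_in[OF this] show ?thesis by (auto elim!: eventually_mono)
  qed
  have G: "(\<lambda>x. ennreal (exp (- x)) * ennreal (potential_density x)) \<in> borel_measurable lborel"
    by measurable
  let ?P = "density U (\<lambda>x. ennreal (exp (- x)))"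
  let ?G = "density lborel (\<lambda>x. ennreal (exp (- x)) * ennreal (potential_density x))"
  \<comment> \<open>The density \<open>exp (- x)\<close> shifts Laplace transforms from \<open>n\<close> to \<open>n + 1 > 0\<close>.\<close>
  have exp_Suc: "exp (- x) * exp (- real n * x) = exp (- real (Suc n) * x)" for n and x :: real
    by (simp add: mult_exp_exp algebra_simps)
  have laplace_P: "(\<integral>\<^sup>+x. ennreal (exp (- real n * x)) \<partial>?P) = ennreal (real (Suc n) powr - \<alpha>)" for n
  proof -
    have "(\<integral>\<^sup>+x. ennreal (exp (- real n * x)) \<partial>?P) = (\<integral>\<^sup>+x. ennreal (exp (- x)) * ennreal (exp (- real n * x)) \<partial>U)"
      by (rule nn_integral_density) measurable
    also have "\<dots> = (\<integral>\<^sup>+x. ennreal (exp (- real (Suc n) * x)) \<partial>U)"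
      by (simp only: exp_Suc[symmetric] ennreal_mult'[OF exp_ge_zero])
    also have "\<dots> = ennreal (real (Suc n) powr - \<alpha>)" by (rule laplace_U) simp
    finally show ?thesis .
  qed
  have laplace_G: "(\<integral>\<^sup>+x. ennreal (exp (- real n * x)) \<partial>?G) = ennreal (real (Suc n) powr - \<alpha>)" for n
  proof -
    have "(\<integral>\<^sup>+x. ennreal (exp (- real n * x)) \<partial>?G) =
        (\<integral>\<^sup>+x. (ennreal (exp (- x)) * ennreal (potential_density x)) * ennreal (exp (- real n * x)) \<partial>lborel)"
      by (rule nn_integral_density) measurable
    also have "\<dots> = (\<integral>\<^sup>+x. ennreal (exp (- real (Suc n) * x)) * ennreal (potential_density x) \<partial>lborel)"
    proof (rule nn_integral_cong)
      fix x :: real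
      have "ennreal (exp (- real (Suc n) * x)) = ennreal (exp (- x)) * ennreal (exp (- real n * x))"
        by (simp only: exp_Suc[symmetric] ennreal_mult'[OF exp_ge_zero])
      then show "(ennreal (exp (- x)) * ennreal (potential_density x)) * ennreal (exp (- real n * x)) =
          ennreal (exp (- real (Suc n) * x)) * ennreal (potential_density x)"
        by (simp only: ac_simps)
    qed
    also have "\<dots> = ennreal (real (Suc n) powr - \<alpha>)"
      unfolding potential_density_def by (rule nn_integral_gamma_exp[OF \<alpha>_pos]) simp
    finally show ?thesis .
  qed
  have "?P = ?G"
  proof (rule real_distribution_eq_if_laplace_eq)
    have prob: "prob_space R" if "(\<integral>\<^sup>+x. ennreal (exp (- real 0 * x)) \<partial>R) = ennreal (real (Suc 0) powr - \<alpha>)" for R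
      by (rule prob_spaceI) (use that in simp)
    show "real_distribution ?P"
      unfolding real_distribution_def real_distribution_axioms_def using prob[OF laplace_P] by simp
    show "real_distribution ?G"
      unfolding real_distribution_def real_distribution_axioms_def using prob[OF laplace_G] by simp
    show "AE x in ?P. 0 \<le> x"
      by (subst AE_density) (use AE_U in \<open>auto elim!: eventually_mono\<close>)
    show "AE x in ?G. 0 \<le> x"
      by (subst AE_density[OF G]) (auto intro!: AE_I2 simp: potential_density_def indicator_def split: if_splits)
    show "(\<integral>\<^sup>+x. ennreal (exp (- real n * x)) \<partial>?P) = (\<integral>\<^sup>+x. ennreal (exp (- real n * x)) \<partial>?G)" for n
      unfolding laplace_P laplace_G ..
  qed
  have cancel: "ennreal (exp (- x)) * ennreal (exp x) = 1" for x :: real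
    by (subst ennreal_mult'[symmetric]) (simp_all add: mult_exp_exp)
  have "(\<integral>\<^sup>+a. (\<integral>\<^sup>+\<omega>. g (L a \<omega>) \<partial>M) * indicator {0..} a \<partial>lborel) = (\<integral>\<^sup>+x. g x \<partial>U)"
    by (rule nn_U[OF g, symmetric])
  also have "\<dots> = (\<integral>\<^sup>+x. ennreal (exp (- x)) * (ennreal (exp x) * g x) \<partial>U)"
    by (simp only: mult.assoc[symmetric] cancel mult_1)
  also have "\<dots> = (\<integral>\<^sup>+x. ennreal (exp x) * g x \<partial>?P)"
    by (rule nn_integral_density[symmetric]) (use g in measurable)
  also have "\<dots> = (\<integral>\<^sup>+x. ennreal (exp x) * g x \<partial>?G)" by (simp only: \<open>?P = ?G\<close>)
  also have "\<dots> = (\<integral>\<^sup>+x. (ennreal (exp (- x)) * ennreal (potential_density x)) * (ennreal (exp x) * g x) \<partial>lborel)"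
    by (rule nn_integral_density[OF G]) (use g in measurable)
  also have "\<dots> = (\<integral>\<^sup>+x. g x * ennreal (potential_density x) \<partial>lborel)"
  proof (rule nn_integral_cong)
    fix x :: real
    have "(ennreal (exp (- x)) * ennreal (potential_density x)) * (ennreal (exp x) * g x) =
      (ennreal (exp (- x)) * ennreal (exp x)) * (g x * ennreal (potential_density x))"
      by (simp only: ac_simps)
    then show "(ennreal (exp (- x)) * ennreal (potential_density x)) * (ennreal (exp x) * g x) = g x * ennreal (potential_density x)"
      by (simp only: cancel mult_1)
  qed
  finally show ?thesis .
qed

end

section \<open>First and second moments of the inverse stable subordinator\<close>

lemma nn_integral_sojourn:
  fixes f :: "real \<Rightarrow> real"
  assumes bounds: "\<And>u. 0 \<le> u \<Longrightarrow> (f u \<le> t \<longrightarrow> u \<le> y) \<and> (u < y \<longrightarrow> f u \<le> t)" and a: "0 \<le> a"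
  shows "(\<integral>\<^sup>+h. indicator {..t} (f (a + h)) * indicator {0..} h \<partial>lborel) = ennreal (y - a)"
proof -
  have "(\<integral>\<^sup>+h. indicator {..t} (f (a + h)) * indicator {0..} h \<partial>lborel) = (\<integral>\<^sup>+h. indicator {0..y - a} h \<partial>lborel)"
  proof (rule nn_integral_cong_AE)
    show "AE h in lborel. (indicator {..t} (f (a + h)) * indicator {0..} h :: ennreal) = indicator {0..y - a} h"
      using AE_lborel_singleton[of "y - a"]
    proof eventually_elim
      case (elim h)
      then show ?case using bounds[of "a + h"] a by (cases "0 \<le> h") (auto simp: indicator_def)
    qed
  qed
  then show ?thesis by (cases "a \<le> y") (simp_all add: ennreal_neg)
qed

text \<open>
  The inner integral is \<open>z - a\<close>, and \<open>a\<close> ranges over an interval from \<open>0\<close> to \<open>y\<close>. Together with the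
  instance \<open>t = s\<close>, \<open>z = y\<close>, whose value is \<open>y\<^sup>2 / 2\<close>, this recovers the product \<open>y * z\<close>.
\<close>

lemma nn_integral_double_sojourn:
  fixes f :: "real \<Rightarrow> real"
  assumes s: "\<And>u. 0 \<le> u \<Longrightarrow> (f u \<le> s \<longrightarrow> u \<le> y) \<and> (u < y \<longrightarrow> f u \<le> s)"
    and t: "\<And>u. 0 \<le> u \<Longrightarrow> (f u \<le> t \<longrightarrow> u \<le> z) \<and> (u < z \<longrightarrow> f u \<le> t)"
    and yz: "0 \<le> y" "y \<le> z"
  shows "(\<integral>\<^sup>+a. (indicator {..s} (f a) * indicator {0..} a) *
      (\<integral>\<^sup>+h. indicator {..t} (f (a + h)) * indicator {0..} h \<partial>lborel) \<partial>lborel) = ennreal (y * z - y\<^sup>2 / 2)"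
proof -
  have "(\<integral>\<^sup>+a. (indicator {..s} (f a) * indicator {0..} a) *
      (\<integral>\<^sup>+h. indicator {..t} (f (a + h)) * indicator {0..} h \<partial>lborel) \<partial>lborel) =
      (\<integral>\<^sup>+a. ennreal (z - a) * indicator {0..y} a \<partial>lborel)"
  proof (rule nn_integral_cong_AE)
    show "AE a in lborel. (indicator {..s} (f a) * indicator {0..} a) *
      (\<integral>\<^sup>+h. indicator {..t} (f (a + h)) * indicator {0..} h \<partial>lborel) = ennreal (z - a) * indicator {0..y} a"
      using AE_lborel_singleton[of y]
    proof eventually_elim
      case (elim a)
      then show ?case using s[of a] nn_integral_sojourn[of f t z a, OF t]
        by (cases "0 \<le> a") (auto simp: indicator_def)
    qed
  qed
  also have "\<dots> = ennreal ((z * y - y\<^sup>2 / 2) - (z * 0 - 0\<^sup>2 / 2))"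
    by (rule nn_integral_FTC_Icc) (use yz in \<open>auto intro!: derivative_eq_intros\<close>)
  finally show ?thesis by (simp add: mult.commute)
qed

context stable_process
begin

lemma potential_mean:
  assumes t: "0 \<le> t"
  shows "(\<integral>\<^sup>+x. indicator {..t} x * ennreal (potential_density x) \<partial>lborel) = ennreal (t powr \<alpha> / Gamma (\<alpha> + 1))"
proof -
  have G: "0 < Gamma \<alpha>" using \<alpha>_pos by (rule Gamma_real_pos)
  have "((\<lambda>x. x powr (\<alpha> - 1)) has_integral (t powr (\<alpha> - 1 + 1) / (\<alpha> - 1 + 1))) {0..t}"
    by (rule has_integral_powr_from_0) (use \<alpha>_pos t in auto)
  then have "((\<lambda>x. x powr (\<alpha> - 1) / Gamma \<alpha>) has_integral (t powr (\<alpha> - 1 + 1) / (\<alpha> - 1 + 1) / Gamma \<alpha>)) {0..t}"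
    by (rule has_integral_divide)
  then have "((\<lambda>x. x powr (\<alpha> - 1) / Gamma \<alpha>) has_integral (t powr \<alpha> / \<alpha> / Gamma \<alpha>)) {0..t}"
    by simp
  then have "(\<integral>\<^sup>+x. ennreal (x powr (\<alpha> - 1) / Gamma \<alpha>) * indicator {0..t} x \<partial>lborel) = ennreal (t powr \<alpha> / \<alpha> / Gamma \<alpha>)"
    by (intro nn_integral_has_integral_lebesgue') (use G in auto)
  moreover have "t powr \<alpha> / \<alpha> / Gamma \<alpha> = t powr \<alpha> / Gamma (\<alpha> + 1)"
    using Gamma_plus1[of \<alpha>] \<alpha>_pos nonpos_Ints_nonpos[of \<alpha>] by force
  moreover have "(\<integral>\<^sup>+x. indicator {..t} x * ennreal (potential_density x) \<partial>lborel) =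
     (\<integral>\<^sup>+x. ennreal (x powr (\<alpha> - 1) / Gamma \<alpha>) * indicator {0..t} x \<partial>lborel)"
    by (rule nn_integral_cong) (auto simp: potential_density_def indicator_def)
  ultimately show ?thesis by (simp only:)
qed

text \<open>
  The first passage time is the time that the path spends in \<open>(-\<infinity>, t]\<close>, and its expectation is the
  potential measure of that set.
\<close>

lemma first_passage_mean:
  assumes t: "0 \<le> t"
  shows "(\<integral>\<^sup>+\<omega>. ennreal (first_passage L t \<omega>) \<partial>M) = ennreal (t powr \<alpha> / Gamma (\<alpha> + 1))"
proof -
  interpret M_lborel: pair_sigma_finite M lborel by unfold_locales
  have "(\<integral>\<^sup>+\<omega>. ennreal (first_passage L t \<omega>) \<partial>M) =
      (\<integral>\<^sup>+\<omega>. (\<integral>\<^sup>+a. indicator {..t} (L (max a 0) \<omega>) * indicator {0..} a \<partial>lborel) \<partial>M)"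
  proof (rule nn_integral_cong_AE)
    show "AE \<omega> in M. ennreal (first_passage L t \<omega>) =
        (\<integral>\<^sup>+a. indicator {..t} (L (max a 0) \<omega>) * indicator {0..} a \<partial>lborel)"
      using AE_first_passage[OF t]
    proof eventually_elim
      case (elim \<omega>)
      have "(\<integral>\<^sup>+a. indicator {..t} (L (max a 0) \<omega>) * indicator {0..} a \<partial>lborel) =
         (\<integral>\<^sup>+a. indicator {..t} (L (0 + a) \<omega>) * indicator {0..} a \<partial>lborel)"
        by (rule nn_integral_cong) (simp add: indicator_def max_absorb1)
      also have "\<dots> = ennreal (first_passage L t \<omega> - 0)"
        by (rule nn_integral_sojourn) (use elim in auto)
      finally show ?case by simp
    qed
  qed
  also have "\<dots> = (\<integral>\<^sup>+a. (\<integral>\<^sup>+\<omega>. indicator {..t} (L (max a 0) \<omega>) * indicator {0..} a \<partial>M) \<partial>lborel)"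
  proof (rule M_lborel.Fubini'[symmetric])
    have "(\<lambda>p. L (max (snd p) 0) (fst p)) \<in> borel_measurable (M \<Otimes>\<^sub>M lborel)"
      by (rule measurable_L_max) measurable
    then have "(\<lambda>p. indicator {..t} (L (max (snd p) 0) (fst p)) * indicator {0..} (snd p) :: ennreal) \<in> borel_measurable (M \<Otimes>\<^sub>M lborel)"
      by (intro borel_measurable_times_ennreal measurable_compose[OF _ borel_measurable_indicator]
          measurable_compose[OF measurable_snd borel_measurable_indicator]) auto
    then show "(\<lambda>(\<omega>, a). indicator {..t} (L (max a 0) \<omega>) * indicator {0..} a :: ennreal) \<in> borel_measurable (M \<Otimes>\<^sub>M lborel)"
      by (simp add: split_beta')
  qed
  also have "\<dots> = (\<integral>\<^sup>+a. (\<integral>\<^sup>+\<omega>. indicator {..t} (L a \<omega>) \<partial>M) * indicator {0..} a \<partial>lborel)"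
    by (rule nn_integral_cong) (auto simp: indicator_def max_absorb1)
  also have "\<dots> = (\<integral>\<^sup>+x. indicator {..t} x * ennreal (potential_density x) \<partial>lborel)"
    by (rule potential_measure_eq) simp
  also have "\<dots> = ennreal (t powr \<alpha> / Gamma (\<alpha> + 1))" by (rule potential_mean[OF t])
  finally show ?thesis .
qed

text \<open>
  The Markov property in the form needed here: after time \<open>a\<close> the path continues like an independent
  copy of \<open>L\<close> started at \<open>L a\<close>.
\<close>

lemma nn_integral_independent_increment:
  assumes a: "0 \<le> a" and h: "0 \<le> h" and k: "k \<in> borel_measurable (borel \<Otimes>\<^sub>M borel)"
  shows "(\<integral>\<^sup>+\<omega>. k (L a \<omega>, L (a + h) \<omega>) \<partial>M) = (\<integral>\<^sup>+\<omega>. (\<integral>\<^sup>+\<omega>'. k (L a \<omega>, L a \<omega> + L h \<omega>') \<partial>M) \<partial>M)"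
proof -
  have L0: "AE \<omega> in M. L 0 \<omega> = 0" using AE_path by eventually_elim simp
  define X where "X \<omega> = L a \<omega> - L 0 \<omega>" for \<omega>
  define D where "D \<omega> = L (a + h) \<omega> - L a \<omega>" for \<omega>
  have X: "X \<in> borel_measurable M" and D: "D \<in> borel_measurable M"
    unfolding X_def[abs_def] D_def[abs_def] using a h by (intro borel_measurable_diff L_measurable; simp)+
  \<comment> \<open>The two increments over \<open>[0, a]\<close> and \<open>[a, a + h]\<close>; \<open>X\<close> equals \<open>L a\<close> only almost surely.\<close>
  define \<tau> :: "nat \<Rightarrow> real" where "\<tau> i = (if i = 0 then 0 else if i = 1 then a else a + h)" for i
  have inc: "independent_increments M L" and stat: "stationary_increments M L"
    using stable unfolding stable_subordinator_def subordinator_def levy_process_def by blast+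
  have "indep_vars (\<lambda>_. borel) (\<lambda>i \<omega>. L (\<tau> (Suc i)) \<omega> - L (\<tau> i) \<omega>) {..<2}"
    using inc a h unfolding independent_increments_def
    by (elim allE[of _ 2] allE[of _ \<tau>] mp) (auto simp: \<tau>_def mono_on_def)
  then have sets: "indep_sets (\<lambda>i. {(\<lambda>\<omega>. L (\<tau> (Suc i)) \<omega> - L (\<tau> i) \<omega>) -` A \<inter> space M | A. A \<in> sets borel}) {..<2}"
    unfolding indep_vars_def2 by simp
  have "indep_set {X -` S \<inter> space M | S. S \<in> sets borel} {D -` T \<inter> space M | T. T \<in> sets borel}"
    unfolding indep_sets2_eq
  proof safe
    fix S T :: "real set" assume S: "S \<in> sets borel" and T: "T \<in> sets borel"
    show "X -` S \<inter> space M \<in> events" "D -` T \<inter> space M \<in> events"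
      using measurable_sets[OF X S] measurable_sets[OF D T] by auto
    have X_eq: "(\<lambda>\<omega>. L (\<tau> (Suc 0)) \<omega> - L (\<tau> 0) \<omega>) = X" and D_eq: "(\<lambda>\<omega>. L (\<tau> (Suc 1)) \<omega> - L (\<tau> 1) \<omega>) = D"
      by (simp_all add: X_def[abs_def] D_def[abs_def] \<tau>_def)
    have "prob (\<Inter>j\<in>{0, 1::nat}. if j = 0 then X -` S \<inter> space M else D -` T \<inter> space M) =
      (\<Prod>j\<in>{0, 1::nat}. prob (if j = 0 then X -` S \<inter> space M else D -` T \<inter> space M))"
    proof (rule indep_setsD[OF sets])
      show "\<forall>j\<in>{0, 1::nat}. (if j = 0 then X -` S \<inter> space M else D -` T \<inter> space M)
          \<in> {(\<lambda>\<omega>. L (\<tau> (Suc j)) \<omega> - L (\<tau> j) \<omega>) -` A \<inter> space M | A. A \<in> sets borel}"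
        using S T X_eq D_eq by auto
    qed auto
    then show "prob ((X -` S \<inter> space M) \<inter> (D -` T \<inter> space M)) = prob (X -` S \<inter> space M) * prob (D -` T \<inter> space M)"
      by (simp add: Int_commute)
  qed
  note indep = this
  have k': "(\<lambda>p. k (fst p, fst p + snd p)) \<in> borel_measurable (borel \<Otimes>\<^sub>M borel)"
    by (rule measurable_compose[OF _ k]) measurable
  have kx: "(\<lambda>d. k (x, x + d)) \<in> borel_measurable borel" for x
    by (rule measurable_compose[OF _ k]) measurable
  have "(\<integral>\<^sup>+\<omega>. k (L a \<omega>, L (a + h) \<omega>) \<partial>M) = (\<integral>\<^sup>+\<omega>. k (X \<omega>, X \<omega> + D \<omega>) \<partial>M)"
    by (rule nn_integral_cong_AE) (use L0 in \<open>auto elim!: eventually_mono simp: X_def D_def\<close>)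
  also have "\<dots> = (\<integral>\<^sup>+\<omega>. (\<integral>\<^sup>+\<omega>'. k (X \<omega>, X \<omega> + D \<omega>') \<partial>M) \<partial>M)"
    using nn_integral_indep_set(2)[OF X D indep k'] by simp
  also have "\<dots> = (\<integral>\<^sup>+\<omega>. (\<integral>\<^sup>+\<omega>'. k (X \<omega>, X \<omega> + L h \<omega>') \<partial>M) \<partial>M)"
  proof (rule nn_integral_cong)
    fix \<omega>
    have distr: "distr M borel D = distr M borel (\<lambda>\<omega>. L h \<omega> - L 0 \<omega>)"
      using stat a h unfolding stationary_increments_def D_def[abs_def] by blast
    have Lh: "(\<lambda>\<omega>. L h \<omega> - L 0 \<omega>) \<in> borel_measurable M"
      using h by (intro borel_measurable_diff L_measurable) auto
    have "(\<integral>\<^sup>+\<omega>'. k (X \<omega>, X \<omega> + D \<omega>') \<partial>M) = (\<integral>\<^sup>+d. k (X \<omega>, X \<omega> + d) \<partial>distr M borel D)"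
      by (rule nn_integral_distr[OF D, symmetric]) (use kx in simp)
    also have "\<dots> = (\<integral>\<^sup>+\<omega>'. k (X \<omega>, X \<omega> + (L h \<omega>' - L 0 \<omega>')) \<partial>M)"
      unfolding distr by (rule nn_integral_distr[OF Lh]) (use kx in simp)
    also have "\<dots> = (\<integral>\<^sup>+\<omega>'. k (X \<omega>, X \<omega> + L h \<omega>') \<partial>M)"
      by (rule nn_integral_cong_AE) (use L0 in \<open>auto elim!: eventually_mono\<close>)
    finally show "(\<integral>\<^sup>+\<omega>'. k (X \<omega>, X \<omega> + D \<omega>') \<partial>M) = (\<integral>\<^sup>+\<omega>'. k (X \<omega>, X \<omega> + L h \<omega>') \<partial>M)" .
  qed
  also have "\<dots> = (\<integral>\<^sup>+\<omega>. (\<integral>\<^sup>+\<omega>'. k (L a \<omega>, L a \<omega> + L h \<omega>') \<partial>M) \<partial>M)"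
    by (rule nn_integral_cong_AE) (use L0 in \<open>auto elim!: eventually_mono simp: X_def\<close>)
  finally show ?thesis .
qed


declare measurable_L_max[measurable (raw)] and L_measurable[measurable (raw)]

text \<open>
  Almost surely the left-hand integrand is the integral over \<open>a, h \<ge> 0\<close> of the indicator of
  \<open>L a \<le> s\<close> and \<open>L (a + h) \<le> t\<close>. After exchanging the integrals, the independent increment turns the
  integral over \<open>h\<close> into the potential of \<open>[0, t - L a]\<close>, and the integral over \<open>a\<close> becomes an
  integral against the potential measure.
\<close>

lemma expected_double_sojourn:
  assumes s: "0 \<le> s" "s \<le> t"
  shows "(\<integral>\<^sup>+\<omega>. ennreal (first_passage L s \<omega> * first_passage L t \<omega> - (first_passage L s \<omega>)\<^sup>2 / 2) \<partial>M) =
    (\<integral>\<^sup>+x. (indicator {..s} x * ennreal ((t - x) powr \<alpha> / Gamma (\<alpha> + 1))) * ennreal (potential_density x) \<partial>lborel)"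
proof -
  interpret M_lborel: pair_sigma_finite M lborel by unfold_locales
  have t: "0 \<le> t" using s by simp
  define Q where "Q \<omega> a = (indicator {..s} (L (max a 0) \<omega>) * indicator {0..} a) *
      (\<integral>\<^sup>+h. indicator {..t} (L (max (a + h) 0) \<omega>) * indicator {0..} h \<partial>lborel)" for \<omega> and a :: real
  define g where "g x = indicator {..s} x * ennreal ((t - x) powr \<alpha> / Gamma (\<alpha> + 1))" for x
  have "(\<integral>\<^sup>+\<omega>. ennreal (first_passage L s \<omega> * first_passage L t \<omega> - (first_passage L s \<omega>)\<^sup>2 / 2) \<partial>M) =
      (\<integral>\<^sup>+\<omega>. (\<integral>\<^sup>+a. Q \<omega> a \<partial>lborel) \<partial>M)"
  proof (rule nn_integral_cong_AE)
    show "AE \<omega> in M. ennreal (first_passage L s \<omega> * first_passage L t \<omega> - (first_passage L s \<omega>)\<^sup>2 / 2) =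
        (\<integral>\<^sup>+a. Q \<omega> a \<partial>lborel)"
      using AE_first_passage[OF s(1)] AE_first_passage[OF t] AE_first_passage_mono[OF s]
    proof eventually_elim
      case (elim \<omega>)
      show ?case unfolding Q_def
        by (rule nn_integral_double_sojourn[symmetric]) (use elim first_passage_nonneg in auto)
    qed
  qed
  also have "\<dots> = (\<integral>\<^sup>+a. (\<integral>\<^sup>+\<omega>. Q \<omega> a \<partial>M) \<partial>lborel)"
  proof (rule M_lborel.Fubini'[symmetric])
    show "(\<lambda>(\<omega>, a). Q \<omega> a) \<in> borel_measurable (M \<Otimes>\<^sub>M lborel)"
      unfolding Q_def by measurable
  qed
  also have "\<dots> = (\<integral>\<^sup>+a. (\<integral>\<^sup>+\<omega>. g (L a \<omega>) \<partial>M) * indicator {0..} a \<partial>lborel)"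
  proof (rule nn_integral_cong)
    fix a :: real
    show "(\<integral>\<^sup>+\<omega>. Q \<omega> a \<partial>M) = (\<integral>\<^sup>+\<omega>. g (L a \<omega>) \<partial>M) * indicator {0..} a"
    proof (cases "0 \<le> a")
      case True
      \<comment> \<open>\<open>H h x\<close> is the probability to be at most \<open>t\<close> at time \<open>h\<close> when started at \<open>x\<close>.\<close>
      define H where "H h x = (\<integral>\<^sup>+\<omega>'. indicator {..t} (x + L (max h 0) \<omega>') \<partial>M)" for h x
      have H_meas: "(\<lambda>(h, x). H h x) \<in> borel_measurable (lborel \<Otimes>\<^sub>M borel)"
        unfolding H_def by measurable
      have "(\<integral>\<^sup>+\<omega>. Q \<omega> a \<partial>M) = (\<integral>\<^sup>+\<omega>. (\<integral>\<^sup>+h. indicator {..s} (L (max a 0) \<omega>) *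
          (indicator {..t} (L (max (a + h) 0) \<omega>) * indicator {0..} h) \<partial>lborel) \<partial>M)"
        unfolding Q_def using True
        by (intro nn_integral_cong) (simp, intro nn_integral_cmult[symmetric], measurable)
      also have "\<dots> = (\<integral>\<^sup>+h. (\<integral>\<^sup>+\<omega>. indicator {..s} (L (max a 0) \<omega>) *
          (indicator {..t} (L (max (a + h) 0) \<omega>) * indicator {0..} h) \<partial>M) \<partial>lborel)"
        by (rule M_lborel.Fubini'[symmetric]) measurable
      also have "\<dots> = (\<integral>\<^sup>+h. (\<integral>\<^sup>+\<omega>. indicator {..s} (L (max a 0) \<omega>) * (H h (L (max a 0) \<omega>) * indicator {0..} h) \<partial>M) \<partial>lborel)"
      proof (rule nn_integral_cong)
        fix h :: real
        show "(\<integral>\<^sup>+\<omega>. indicator {..s} (L (max a 0) \<omega>) * (indicator {..t} (L (max (a + h) 0) \<omega>) * indicator {0..} h) \<partial>M) =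
          (\<integral>\<^sup>+\<omega>. indicator {..s} (L (max a 0) \<omega>) * (H h (L (max a 0) \<omega>) * indicator {0..} h) \<partial>M)"
        proof (cases "0 \<le> h")
          case h: True
          have "(\<integral>\<^sup>+\<omega>. (\<lambda>p. indicator {..s} (fst p) * indicator {..t} (snd p)) (L a \<omega>, L (a + h) \<omega>) \<partial>M) =
             (\<integral>\<^sup>+\<omega>. (\<integral>\<^sup>+\<omega>'. (\<lambda>p. indicator {..s} (fst p) * indicator {..t} (snd p)) (L a \<omega>, L a \<omega> + L h \<omega>') \<partial>M) \<partial>M)"
            by (rule nn_integral_independent_increment[OF True h]) measurable
          also have "\<dots> = (\<integral>\<^sup>+\<omega>. indicator {..s} (L a \<omega>) * H h (L a \<omega>) \<partial>M)"
            using h L_measurable[OF h]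
            by (intro nn_integral_cong) (simp add: H_def max_absorb1, intro nn_integral_cmult, measurable)
          finally show ?thesis using True h by (simp add: max_absorb1)
        qed simp
      qed
      also have "\<dots> = (\<integral>\<^sup>+\<omega>. (\<integral>\<^sup>+h. indicator {..s} (L (max a 0) \<omega>) * (H h (L (max a 0) \<omega>) * indicator {0..} h) \<partial>lborel) \<partial>M)"
        by (rule M_lborel.Fubini') (use H_meas in measurable)
      also have "\<dots> = (\<integral>\<^sup>+\<omega>. g (L a \<omega>) \<partial>M)"
      proof (rule nn_integral_cong)
        fix \<omega>
        define x where "x = L a \<omega>"
        have "(\<integral>\<^sup>+h. H h x * indicator {0..} h \<partial>lborel) = ennreal ((t - x) powr \<alpha> / Gamma (\<alpha> + 1))" if "x \<le> s"
        proof -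
          have "(\<integral>\<^sup>+h. H h x * indicator {0..} h \<partial>lborel) =
              (\<integral>\<^sup>+h. (\<integral>\<^sup>+\<omega>'. indicator {..t - x} (L h \<omega>') \<partial>M) * indicator {0..} h \<partial>lborel)"
            by (rule nn_integral_cong)
               (auto simp: H_def indicator_def max_absorb1 le_diff_eq add.commute intro!: nn_integral_cong)
          also have "\<dots> = (\<integral>\<^sup>+y. indicator {..t - x} y * ennreal (potential_density y) \<partial>lborel)"
            by (rule potential_measure_eq) simp
          also have "\<dots> = ennreal ((t - x) powr \<alpha> / Gamma (\<alpha> + 1))"
            by (rule potential_mean) (use that s in simp)
          finally show ?thesis .
        qed
        then show "(\<integral>\<^sup>+h. indicator {..s} (L (max a 0) \<omega>) * (H h (L (max a 0) \<omega>) * indicator {0..} h) \<partial>lborel) = g (L a \<omega>)"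
          using True by (cases "x \<le> s") (simp_all add: g_def x_def max_absorb1)
      qed
      finally show ?thesis using True by simp
    qed (simp add: Q_def)
  qed
  also have "\<dots> = (\<integral>\<^sup>+x. g x * ennreal (potential_density x) \<partial>lborel)"
    by (rule potential_measure_eq) (unfold g_def[abs_def], measurable)
  finally show ?thesis unfolding g_def .
qed

end

context stable_process
begin

text \<open>
  This is \<open>q s t = \<integral>\<^sub>[\<^sub>0\<^sub>,\<^sub>s\<^sub>] V (t - x) U(dx)\<close> for \<open>s \<le> t\<close>, with \<open>U\<close> the potential measure and
  \<open>V t = U [0, t]\<close>. It is an incomplete Beta integral.
\<close>

definition correlation_potential :: "real \<Rightarrow> real \<Rightarrow> real" where
  "correlation_potential s t = enn2real (\<integral>\<^sup>+x. (indicator {..s} x * ennreal ((t - x) powr \<alpha> / Gamma (\<alpha> + 1))) *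
     ennreal (potential_density x) \<partial>lborel)"

lemma Gamma_\<alpha>_pos: "0 < Gamma \<alpha>" "0 < Gamma (\<alpha> + 1)"
  using \<alpha>_pos by (auto intro!: Gamma_real_pos)

lemma Gamma_\<alpha>_plus1: "Gamma (\<alpha> + 1) = \<alpha> * Gamma \<alpha>"
  using Gamma_plus1[of \<alpha>] \<alpha>_pos nonpos_Ints_nonpos[of \<alpha>] by force

text \<open>
  On \<open>[0, s]\<close> the monotone function \<open>x \<mapsto> V (t - x)\<close> lies between \<open>V (t - s)\<close> and \<open>V t\<close>, and \<open>[0, s]\<close>
  has potential \<open>V s\<close>.
\<close>

lemma correlation_potential_bounds:
  assumes s: "0 \<le> s" "s \<le> t"
  defines "V \<equiv> \<lambda>u. u powr \<alpha> / Gamma (\<alpha> + 1)"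
  shows "(\<integral>\<^sup>+x. (indicator {..s} x * ennreal ((t - x) powr \<alpha> / Gamma (\<alpha> + 1))) *
     ennreal (potential_density x) \<partial>lborel) = ennreal (correlation_potential s t)" (is "?I = _")
    and "V (t - s) * V s \<le> correlation_potential s t" and "correlation_potential s t \<le> V t * V s"
proof -
  have V0: "0 \<le> V u" for u using Gamma_\<alpha>_pos by (simp add: V_def)
  have V_mono: "V u \<le> V w" if "0 \<le> u" "u \<le> w" for u w
    using that \<alpha>_pos Gamma_\<alpha>_pos by (auto simp: V_def intro!: divide_right_mono powr_mono2)
  have mean: "ennreal (V u * V s) = (\<integral>\<^sup>+x. ennreal (V u) * (indicator {..s} x * ennreal (potential_density x)) \<partial>lborel)" for u
    by (subst nn_integral_cmult) (simp_all add: potential_mean[OF s(1)] ennreal_mult'[OF V0], simp add: V_def)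
  have upper: "?I \<le> ennreal (V t * V s)"
    unfolding mean
  proof (rule nn_integral_mono)
    fix x :: real
    show "indicator {..s} x * ennreal ((t - x) powr \<alpha> / Gamma (\<alpha> + 1)) * ennreal (potential_density x) \<le>
        ennreal (V t) * (indicator {..s} x * ennreal (potential_density x))"
    proof (cases "0 \<le> x \<and> x \<le> s")
      case True
      then have "ennreal (V (t - x)) \<le> ennreal (V t)"
        using s by (intro ennreal_leI V_mono) auto
      then show ?thesis using True by (simp add: V_def mult_right_mono)
    qed (auto simp: potential_density_def indicator_def)
  qed
  have lower: "ennreal (V (t - s) * V s) \<le> ?I"
    unfolding mean
  proof (rule nn_integral_mono)
    fix x :: real
    show "ennreal (V (t - s)) * (indicator {..s} x * ennreal (potential_density x)) \<le>
        indicator {..s} x * ennreal ((t - x) powr \<alpha> / Gamma (\<alpha> + 1)) * ennreal (potential_density x)"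
    proof (cases "0 \<le> x \<and> x \<le> s")
      case True
      then have "ennreal (V (t - s)) \<le> ennreal (V (t - x))"
        using s by (intro ennreal_leI V_mono) auto
      then show ?thesis using True by (simp add: V_def mult_right_mono)
    qed (auto simp: potential_density_def indicator_def)
  qed
  have "?I < \<top>" by (rule le_less_trans[OF upper]) simp
  then show eq: "?I = ennreal (correlation_potential s t)"
    unfolding correlation_potential_def by (intro ennreal_enn2real[symmetric])
  have q0: "0 \<le> correlation_potential s t" by (simp add: correlation_potential_def)
  show "V (t - s) * V s \<le> correlation_potential s t" using lower unfolding eq by (subst (asm) ennreal_le_iff[OF q0])
  show "correlation_potential s t \<le> V t * V s" using upper V0 unfolding eq by (subst (asm) ennreal_le_iff) auto
qed

text \<open>
  Substituting \<open>t x\<close> for \<open>x\<close>: one factor \<open>t\<close> comes from \<open>dx\<close>, a factor \<open>t\<^sup>\<alpha>\<^sup>-\<^sup>1\<close> from the density and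
  a factor \<open>t\<^sup>\<alpha>\<close> from \<open>V\<close>.
\<close>

lemma correlation_potential_diagonal:
  assumes t: "0 < t"
  shows "correlation_potential t t = correlation_potential 1 1 * t powr (2 * \<alpha>)"
proof -
  have "ennreal (correlation_potential t t) =
      ennreal \<bar>t\<bar> * (\<integral>\<^sup>+x. (indicator {..t} (0 + t * x) * ennreal ((t - (0 + t * x)) powr \<alpha> / Gamma (\<alpha> + 1))) *
     ennreal (potential_density (0 + t * x)) \<partial>lborel)"
    unfolding correlation_potential_bounds(1)[OF less_imp_le[OF t] order_refl, symmetric]
    by (rule nn_integral_real_affine) (use t in auto)
  also have "\<dots> = (\<integral>\<^sup>+x. ennreal t * ((indicator {..t} (0 + t * x) * ennreal ((t - (0 + t * x)) powr \<alpha> / Gamma (\<alpha> + 1))) *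
     ennreal (potential_density (0 + t * x))) \<partial>lborel)"
    using t by (subst nn_integral_cmult) auto
  also have "\<dots> = (\<integral>\<^sup>+x. ennreal (t powr (2 * \<alpha>)) * ((indicator {..1} x * ennreal ((1 - x) powr \<alpha> / Gamma (\<alpha> + 1))) *
     ennreal (potential_density x)) \<partial>lborel)"
  proof (rule nn_integral_cong)
    fix x :: real
    show "ennreal t * ((indicator {..t} (0 + t * x) * ennreal ((t - (0 + t * x)) powr \<alpha> / Gamma (\<alpha> + 1))) *
        ennreal (potential_density (0 + t * x))) =
      ennreal (t powr (2 * \<alpha>)) * ((indicator {..1} x * ennreal ((1 - x) powr \<alpha> / Gamma (\<alpha> + 1))) * ennreal (potential_density x))"
    proof (cases "0 \<le> x \<and> x \<le> 1")
      case True
      have "(t - t * x) powr \<alpha> = t powr \<alpha> * (1 - x) powr \<alpha>"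
        using t True powr_mult[of t "1 - x" \<alpha>] by (simp add: right_diff_distrib)
      moreover have "(t * x) powr (\<alpha> - 1) = t powr (\<alpha> - 1) * x powr (\<alpha> - 1)"
        by (rule powr_mult)
      moreover have "t * (t powr \<alpha> * t powr (\<alpha> - 1)) = t powr (2 * \<alpha>)"
      proof -
        have "t * (t powr \<alpha> * t powr (\<alpha> - 1)) = t powr 1 * (t powr \<alpha> * t powr (\<alpha> - 1))" using t by simp
        also have "\<dots> = t powr (1 + (\<alpha> + (\<alpha> - 1)))" by (simp only: powr_add)
        finally show ?thesis by simp
      qed
      moreover have "t * (A * B / C * (A' * B' / C')) = t * (A * A') * (B / C * (B' / C'))" for A B C A' B' C'
        by simp
      ultimately have eq: "t * ((t - t * x) powr \<alpha> / Gamma (\<alpha> + 1) * ((t * x) powr (\<alpha> - 1) / Gamma \<alpha>)) =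
        t powr (2 * \<alpha>) * ((1 - x) powr \<alpha> / Gamma (\<alpha> + 1) * (x powr (\<alpha> - 1) / Gamma \<alpha>))"
        by (simp only:)
      have le: "t * x \<le> t" using True t by (simp add: mult_left_le)
      have t0: "0 \<le> t" and tp: "0 \<le> t powr (2 * \<alpha>)" using t by simp_all
      have A0: "0 \<le> (t - t * x) powr \<alpha> / Gamma (\<alpha> + 1)" and B0: "0 \<le> (1 - x) powr \<alpha> / Gamma (\<alpha> + 1)"
        using Gamma_\<alpha>_pos by simp_all
      have "ennreal t * (ennreal ((t - t * x) powr \<alpha> / Gamma (\<alpha> + 1)) * ennreal ((t * x) powr (\<alpha> - 1) / Gamma \<alpha>)) =
        ennreal (t powr (2 * \<alpha>)) * (ennreal ((1 - x) powr \<alpha> / Gamma (\<alpha> + 1)) * ennreal (x powr (\<alpha> - 1) / Gamma \<alpha>))"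
        using arg_cong[OF eq, of ennreal]
        by (simp only: ennreal_mult'[OF t0] ennreal_mult'[OF tp] ennreal_mult'[OF A0] ennreal_mult'[OF B0])
      then show ?thesis
        using le True t0 by (simp add: potential_density_def)
    next
      case False
      then have "potential_density x = 0 \<and> potential_density (t * x) = 0 \<or> 1 < x"
        using t by (auto simp: potential_density_def zero_le_mult_iff not_le)
      then show ?thesis using t by auto
    qed
  qed
  also have "\<dots> = ennreal (t powr (2 * \<alpha>)) * ennreal (correlation_potential 1 1)"
    by (subst nn_integral_cmult) (simp_all add: correlation_potential_bounds(1)[OF zero_le_one order_refl])
  also have "\<dots> = ennreal (t powr (2 * \<alpha>) * correlation_potential 1 1)"
    by (rule ennreal_mult'[symmetric]) simp
  finally have "correlation_potential t t = t powr (2 * \<alpha>) * correlation_potential 1 1"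
    by (subst (asm) ennreal_inj) (simp_all add: correlation_potential_def)
  then show ?thesis by simp
qed

text \<open>
  The number is the variance of the first passage time at level \<open>1\<close>. Since \<open>(1 - x)\<^sup>\<alpha> \<ge> 1 - x\<close> on
  \<open>[0, 1]\<close>, the second moment is at least \<open>2 / (1 + \<alpha>)\<close> times the square of the mean, and
  \<open>2 / (1 + \<alpha>) > 1\<close>.
\<close>

lemma first_passage_variance_coefficient_pos:
  assumes \<alpha>1: "\<alpha> < 1"
  shows "0 < 2 * correlation_potential 1 1 - 1 / (Gamma (\<alpha> + 1))\<^sup>2"
proof -
  let ?G = "Gamma (\<alpha> + 1)"
  have "((\<lambda>x. x powr (\<alpha> - 1)) has_integral (1 powr (\<alpha> - 1 + 1) / (\<alpha> - 1 + 1))) {0..1}"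
    by (rule has_integral_powr_from_0) (use \<alpha>_pos in auto)
  moreover have "((\<lambda>x. x powr \<alpha>) has_integral (1 powr (\<alpha> + 1) / (\<alpha> + 1))) {0..1}"
    by (rule has_integral_powr_from_0) (use \<alpha>_pos in auto)
  ultimately have "((\<lambda>x. (x powr (\<alpha> - 1) - x powr \<alpha>) / (?G * Gamma \<alpha>)) has_integral
      ((1 powr (\<alpha> - 1 + 1) / (\<alpha> - 1 + 1) - 1 powr (\<alpha> + 1) / (\<alpha> + 1)) / (?G * Gamma \<alpha>))) {0..1}"
    by (intro has_integral_divide has_integral_diff)
  moreover have "(1 powr (\<alpha> - 1 + 1) / (\<alpha> - 1 + 1) - 1 powr (\<alpha> + 1) / (\<alpha> + 1)) / (?G * Gamma \<alpha>) = 1 / ((\<alpha> + 1) * ?G\<^sup>2)"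
  proof -
    have "1 / \<alpha> - 1 / (\<alpha> + 1) = 1 / (\<alpha> * (\<alpha> + 1))"
      using \<alpha>_pos by (simp add: field_simps)
    then show ?thesis by (simp add: power2_eq_square Gamma_\<alpha>_plus1)
  qed
  ultimately have "((\<lambda>x. (x powr (\<alpha> - 1) - x powr \<alpha>) / (?G * Gamma \<alpha>)) has_integral (1 / ((\<alpha> + 1) * ?G\<^sup>2))) {0..1}"
    by simp
  moreover have pw: "x powr (\<alpha> - 1) - x powr \<alpha> = (1 - x) * x powr (\<alpha> - 1)" if "0 \<le> x" for x :: real
    using that powr_mult_base[of x "\<alpha> - 1"] by (simp add: algebra_simps)
  ultimately have int: "(\<integral>\<^sup>+x. ennreal ((x powr (\<alpha> - 1) - x powr \<alpha>) / (?G * Gamma \<alpha>)) * indicator {0..1} x \<partial>lborel) = ennreal (1 / ((\<alpha> + 1) * ?G\<^sup>2))"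
    using Gamma_\<alpha>_pos by (intro nn_integral_has_integral_lebesgue') auto
  have "ennreal (1 / ((\<alpha> + 1) * ?G\<^sup>2)) \<le> ennreal (correlation_potential 1 1)"
    unfolding int[symmetric] correlation_potential_bounds(1)[OF zero_le_one order_refl, symmetric]
  proof (rule nn_integral_mono)
    fix x :: real
    show "ennreal ((x powr (\<alpha> - 1) - x powr \<alpha>) / (?G * Gamma \<alpha>)) * indicator {0..1} x \<le>
      indicator {..1} x * ennreal ((1 - x) powr \<alpha> / ?G) * ennreal (potential_density x)"
    proof (cases "0 \<le> x \<and> x \<le> 1")
      case True
      have "1 - x \<le> (1 - x) powr \<alpha>"
        using True \<alpha>1 \<alpha>_pos powr_mono'[of \<alpha> 1 "1 - x"] by simp
      then have "(1 - x) * x powr (\<alpha> - 1) \<le> (1 - x) powr \<alpha> * x powr (\<alpha> - 1)"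
        by (rule mult_right_mono) simp
      then have "(x powr (\<alpha> - 1) - x powr \<alpha>) / (?G * Gamma \<alpha>) \<le> (1 - x) powr \<alpha> * x powr (\<alpha> - 1) / (?G * Gamma \<alpha>)"
        unfolding pw[OF conjunct1[OF True]] using Gamma_\<alpha>_pos by (intro divide_right_mono) auto
      also have "\<dots> = (1 - x) powr \<alpha> / ?G * potential_density x"
        using True by (simp add: potential_density_def)
      finally have "ennreal ((x powr (\<alpha> - 1) - x powr \<alpha>) / (?G * Gamma \<alpha>)) \<le> ennreal ((1 - x) powr \<alpha> / ?G) * ennreal (potential_density x)"
        using Gamma_\<alpha>_pos by (subst ennreal_mult'[symmetric]) (auto intro: ennreal_leI)
      then show ?thesis using True by simp
    qed (auto simp: indicator_def)
  qed
  then have "1 / ((\<alpha> + 1) * ?G\<^sup>2) \<le> correlation_potential 1 1"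
    by (subst (asm) ennreal_le_iff) (simp_all add: correlation_potential_def)
  moreover have "1 / ?G\<^sup>2 < 2 * (1 / ((\<alpha> + 1) * ?G\<^sup>2))"
  proof -
    have "1 < 2 / (\<alpha> + 1)" using \<alpha>_pos \<alpha>1 by simp
    then have "1 * (1 / ?G\<^sup>2) < 2 / (\<alpha> + 1) * (1 / ?G\<^sup>2)"
      using Gamma_\<alpha>_pos by (intro mult_strict_right_mono) auto
    then show ?thesis by simp
  qed
  ultimately show ?thesis by simp
qed

text \<open>
  By the bounds on \<open>q s t\<close> the difference is at most \<open>V s * (V t - V (t - s))\<close>, and
  \<open>t\<^sup>\<alpha> - (t - s)\<^sup>\<alpha> \<le> s t\<^sup>\<alpha>\<^sup>-\<^sup>1\<close>, which tends to \<open>0\<close> because \<open>\<alpha> < 1\<close>.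
\<close>

lemma correlation_potential_asymptotic:
  assumes \<alpha>1: "\<alpha> < 1" and s: "0 < s"
  defines "V \<equiv> \<lambda>u. u powr \<alpha> / Gamma (\<alpha> + 1)"
  shows "((\<lambda>t. correlation_potential s t - V s * V t) \<longlongrightarrow> 0) at_top"
proof (rule Lim_null_comparison)
  have "((\<lambda>t. t powr (\<alpha> - 1)) \<longlongrightarrow> 0) at_top"
    by (rule tendsto_neg_powr) (use \<alpha>1 in \<open>auto intro: filterlim_ident\<close>)
  from tendsto_mult_right_zero[OF this, of "V s * s / Gamma (\<alpha> + 1)"]
  show "((\<lambda>t. V s * s / Gamma (\<alpha> + 1) * t powr (\<alpha> - 1)) \<longlongrightarrow> 0) at_top" .
  show "\<forall>\<^sub>F t in at_top. norm (correlation_potential s t - V s * V t) \<le> V s * s / Gamma (\<alpha> + 1) * t powr (\<alpha> - 1)"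
    using eventually_ge_at_top[of s]
  proof eventually_elim
    case (elim t)
    have t: "0 < t" using elim s by simp
    have lo: "V (t - s) * V s \<le> correlation_potential s t" and hi: "correlation_potential s t \<le> V t * V s"
      using correlation_potential_bounds(2,3)[OF less_imp_le[OF s] elim] by (simp_all add: V_def)
    have "t powr \<alpha> - s * t powr (\<alpha> - 1) = t powr \<alpha> * (1 - s / t)"
      using t by (simp add: right_diff_distrib powr_diff)
    also have "1 - s / t \<le> (1 - s / t) powr \<alpha>"
      using s t elim \<alpha>1 \<alpha>_pos powr_mono'[of \<alpha> 1 "1 - s / t"] by simp
    then have "t powr \<alpha> * (1 - s / t) \<le> t powr \<alpha> * (1 - s / t) powr \<alpha>"
      by (intro mult_left_mono) auto
    also have "\<dots> = (t - s) powr \<alpha>"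
      using t s elim powr_mult[of t "1 - s / t" \<alpha>] by (simp add: right_diff_distrib)
    finally have "(t powr \<alpha> - s * t powr (\<alpha> - 1)) / Gamma (\<alpha> + 1) \<le> V (t - s)"
      unfolding V_def using Gamma_\<alpha>_pos by (intro divide_right_mono) auto
    then have "V t - V (t - s) \<le> s * t powr (\<alpha> - 1) / Gamma (\<alpha> + 1)"
      unfolding V_def by (simp add: diff_divide_distrib)
    then have "V s * (V t - V (t - s)) \<le> V s * (s * t powr (\<alpha> - 1) / Gamma (\<alpha> + 1))"
      using Gamma_\<alpha>_pos by (intro mult_left_mono) (auto simp: V_def)
    then show ?case using lo hi by (simp add: algebra_simps)
  qed
qed

text \<open>
  For \<open>y \<le> z\<close> the product \<open>y z\<close> is the sum of \<open>y z - y\<^sup>2 / 2\<close> and \<open>y\<^sup>2 / 2\<close>: the contributions of the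
  pairs of times in their two possible orders.
\<close>

lemma first_passage_product_mean:
  assumes s: "0 \<le> s" "s \<le> t"
    and [measurable]: "first_passage L s \<in> borel_measurable M" "first_passage L t \<in> borel_measurable M"
  shows "(\<integral>\<^sup>+\<omega>. ennreal (first_passage L s \<omega> * first_passage L t \<omega>) \<partial>M) =
    ennreal (correlation_potential s t + correlation_potential s s)"
proof -
  let ?y = "first_passage L s" and ?z = "first_passage L t"
  have "(\<integral>\<^sup>+\<omega>. ennreal (?y \<omega> * ?z \<omega>) \<partial>M) =
    (\<integral>\<^sup>+\<omega>. ennreal (?y \<omega> * ?z \<omega> - (?y \<omega>)\<^sup>2 / 2) + ennreal (?y \<omega> * ?y \<omega> - (?y \<omega>)\<^sup>2 / 2) \<partial>M)"
  proof (rule nn_integral_cong_AE)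
    show "AE \<omega> in M. ennreal (?y \<omega> * ?z \<omega>) =
        ennreal (?y \<omega> * ?z \<omega> - (?y \<omega>)\<^sup>2 / 2) + ennreal (?y \<omega> * ?y \<omega> - (?y \<omega>)\<^sup>2 / 2)"
      using AE_first_passage_mono[OF s]
    proof eventually_elim
      case (elim \<omega>)
      have "?y \<omega> * ?y \<omega> \<le> ?y \<omega> * ?z \<omega>"
        using elim first_passage_nonneg[of L s \<omega>] by (rule mult_left_mono)
      moreover have "0 \<le> ?y \<omega> * ?y \<omega>" by simp
      ultimately have "0 \<le> ?y \<omega> * ?z \<omega> - (?y \<omega>)\<^sup>2 / 2" "0 \<le> ?y \<omega> * ?y \<omega> - (?y \<omega>)\<^sup>2 / 2"
        unfolding power2_eq_square by linarith+
      then have "ennreal (?y \<omega> * ?z \<omega> - (?y \<omega>)\<^sup>2 / 2) + ennreal (?y \<omega> * ?y \<omega> - (?y \<omega>)\<^sup>2 / 2) =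
         ennreal ((?y \<omega> * ?z \<omega> - (?y \<omega>)\<^sup>2 / 2) + (?y \<omega> * ?y \<omega> - (?y \<omega>)\<^sup>2 / 2))"
        by (rule ennreal_plus[symmetric])
      then show ?case by (simp add: power2_eq_square)
    qed
  qed
  also have "\<dots> = ennreal (correlation_potential s t) + ennreal (correlation_potential s s)"
    by (subst nn_integral_add)
       (simp_all only: expected_double_sojourn[OF s] expected_double_sojourn[OF s(1) order_refl]
         correlation_potential_bounds(1)[OF s] correlation_potential_bounds(1)[OF s(1) order_refl], measurable)
  also have "\<dots> = ennreal (correlation_potential s t + correlation_potential s s)"
    by (rule ennreal_plus[symmetric]) (simp_all add: correlation_potential_def)
  finally show ?thesis .
qed

end

section \<open>Long-range dependence\<close>

lemma (in prob_space) covariance_nonneg_eq: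
  assumes U[measurable]: "U \<in> borel_measurable M" and V[measurable]: "V \<in> borel_measurable M"
    and U0: "\<And>\<omega>. 0 \<le> U \<omega>" and V0: "\<And>\<omega>. 0 \<le> V \<omega>"
    and nn_U: "(\<integral>\<^sup>+\<omega>. ennreal (U \<omega>) \<partial>M) = ennreal a" and nn_V: "(\<integral>\<^sup>+\<omega>. ennreal (V \<omega>) \<partial>M) = ennreal b"
    and nn_UV: "(\<integral>\<^sup>+\<omega>. ennreal (U \<omega> * V \<omega>) \<partial>M) = ennreal c"
    and nonneg: "0 \<le> a" "0 \<le> b" "0 \<le> c"
  shows "covariance M U V = c - a * b"
proof -
  have int_U: "integrable M U" and int_V: "integrable M V" and int_UV: "integrable M (\<lambda>\<omega>. U \<omega> * V \<omega>)"
    using U0 V0 by (auto intro!: integrableI_nn_integral_finite[OF _ _ nn_U] integrableI_nn_integral_finite[OF _ _ nn_V]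
        integrableI_nn_integral_finite[OF _ _ nn_UV])
  have a: "expectation U = a" and b: "expectation V = b" and c: "expectation (\<lambda>\<omega>. U \<omega> * V \<omega>) = c"
    using U0 V0 nonneg by (simp_all add: integral_eq_nn_integral nn_U nn_V nn_UV)
  have "covariance M U V = expectation (\<lambda>\<omega>. U \<omega> * V \<omega> - a * V \<omega> - b * U \<omega> + a * b)"
    unfolding covariance_def a b by (rule Bochner_Integration.integral_cong) (simp_all add: algebra_simps)
  also have "\<dots> = c - a * b - b * a + a * b"
    using int_U int_V int_UV by (simp add: a b c prob_space)
  finally show ?thesis by simp
qed

text \<open>
  The variance \<open>A t\<^sup>\<alpha> + B t\<^sup>2\<^sup>\<alpha>\<close> is dominated by its second term, whose square root cancels the
  factor \<open>t\<^sup>\<alpha>\<close>.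
\<close>

lemma tendsto_power_law_correlation:
  fixes g :: "real \<Rightarrow> real"
  assumes \<alpha>: "0 < \<alpha>" and B: "0 < B" and C: "0 < C" and g: "(g \<longlongrightarrow> c) at_top"
  shows "((\<lambda>t. g t / sqrt (C * (A * t powr \<alpha> + B * t powr (2 * \<alpha>))) / t powr (- \<alpha>)) \<longlongrightarrow> c / sqrt (C * B)) at_top"
proof -
  have "((\<lambda>t. t powr (- \<alpha>)) \<longlongrightarrow> 0) at_top"
    by (rule tendsto_neg_powr) (use \<alpha> in \<open>auto intro: filterlim_ident\<close>)
  then have "((\<lambda>t. g t / sqrt (C * (A * t powr (- \<alpha>) + B))) \<longlongrightarrow> c / sqrt (C * (A * 0 + B))) at_top"
    using B C by (intro tendsto_intros g) auto
  then have "((\<lambda>t. g t / sqrt (C * (A * t powr (- \<alpha>) + B))) \<longlongrightarrow> c / sqrt (C * B)) at_top" by simp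
  moreover have "\<forall>\<^sub>F t in at_top. g t / sqrt (C * (A * t powr (- \<alpha>) + B)) =
      g t / sqrt (C * (A * t powr \<alpha> + B * t powr (2 * \<alpha>))) / t powr (- \<alpha>)"
    using eventually_gt_at_top[of "0::real"]
  proof eventually_elim
    case (elim t)
    define p where "p = t powr \<alpha>"
    have p: "0 < p" using elim by (simp add: p_def)
    have p2: "t powr (2 * \<alpha>) = p\<^sup>2" and pm: "t powr (- \<alpha>) = 1 / p"
      using elim by (simp_all add: p_def powr_minus_divide power2_eq_square powr_add[symmetric])
    have "C * (A * p + B * p\<^sup>2) = C * (A * (1 / p) + B) * p\<^sup>2"
      using p by (simp add: distrib_left distrib_right power2_eq_square)
    then have "sqrt (C * (A * p + B * p\<^sup>2)) = sqrt (C * (A * (1 / p) + B)) * p"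
      using p by (simp only: real_sqrt_mult real_sqrt_abs abs_of_pos)
    then show ?case
      unfolding p2 pm p_def[symmetric] using p by simp
  qed
  ultimately show ?thesis by (rule Lim_transform_eventually)
qed

theorem theorem3p1:
  fixes M :: "'a measure" and \<alpha> l :: real and k :: nat
    and N :: "real \<Rightarrow> 'a \<Rightarrow> nat" and Y :: "real \<Rightarrow> 'a \<Rightarrow> real"
  assumes "prob_space M"
    and "0 < \<alpha>" and "\<alpha> < 1" and "k \<ge> 1" and "l > 0"
    and "poisson_process_of_order M k l N"
    and "inverse_stable_subordinator M \<alpha> Y"
    and "independent_processes M {0..} (count_space UNIV) N {0..} borel Y"
  shows "long_range_dependent M (\<lambda>t \<omega>. real (N (Y t \<omega>) \<omega>))"
proof -
  interpret prob_space M by fact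
  note \<alpha>0 = assms(2) and \<alpha>1 = assms(3) and k = assms(4) and l = assms(5) and N = assms(6) and indep = assms(8)
  obtain L where L: "stable_subordinator M \<alpha> L"
    and Y: "\<And>t \<omega>. 0 \<le> t \<Longrightarrow> \<omega> \<in> space M \<Longrightarrow> Y t \<omega> = first_passage L t \<omega>"
    using assms(7) unfolding inverse_stable_subordinator_def by blast
  interpret stable_process M \<alpha> L by unfold_locales fact+
  define Z where "Z t \<omega> = real (N (Y t \<omega>) \<omega>)" for t \<omega>
  define G where "G = Gamma (\<alpha> + 1)"
  define V where "V t = t powr \<alpha> / G" for t
  define m where "m = l * (\<Sum>i=1..k. real i)"
  define v where "v = l * (\<Sum>i=1..k. (real i)\<^sup>2)"
  define q where "q = correlation_potential"
  have G: "0 < G" using Gamma_\<alpha>_pos by (simp add: G_def)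
  have q0: "0 \<le> q s t" for s t by (simp add: q_def correlation_potential_def)
  have V0: "0 \<le> V t" for t using G by (simp add: V_def)
  have "0 < (\<Sum>i=1..k. real i)" "0 < (\<Sum>i=1..k. (real i)\<^sup>2)" using k by (auto intro!: sum_pos)
  then have m: "0 < m" and v: "0 < v" using l by (simp_all add: m_def v_def)
  have Y0: "0 \<le> Y t \<omega>" if "0 \<le> t" "\<omega> \<in> space M" for t \<omega>
    using Y[OF that] first_passage_nonneg[of L t \<omega>] by simp
  have Y_meas: "Y t \<in> borel_measurable M" if "0 \<le> t" for t
  proof -
    have path: "(\<lambda>\<omega>. \<lambda>i\<in>{0..}. Y i \<omega>) \<in> measurable M (PiM {0..} (\<lambda>_. borel))"
      using indep unfolding independent_processes_def Let_def by blast
    have "(\<lambda>\<omega>. (\<lambda>i\<in>{0..}. Y i \<omega>) t) \<in> borel_measurable M"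
      by (rule measurable_compose[OF path measurable_component_singleton]) (use that in simp)
    then show ?thesis using that by simp
  qed
  have fp_meas: "first_passage L t \<in> borel_measurable M" if "0 \<le> t" for t
    using Y_meas[OF that] by (subst (asm) measurable_cong[OF Y[OF that]])
  have mean_Y: "(\<integral>\<^sup>+\<omega>. ennreal (Y t \<omega>) \<partial>M) = ennreal (V t)" if "0 \<le> t" for t
    using first_passage_mean[OF that] by (simp add: V_def G_def Y[OF that] cong: nn_integral_cong_simp)
  have prod_Y: "(\<integral>\<^sup>+\<omega>. ennreal (Y s \<omega> * Y t \<omega>) \<partial>M) = ennreal (q s t + q s s)" if st: "0 \<le> s" "s \<le> t" for s t
  proof -
    have t: "0 \<le> t" using st by simp
    have "(\<integral>\<^sup>+\<omega>. ennreal (Y s \<omega> * Y t \<omega>) \<partial>M) = (\<integral>\<^sup>+\<omega>. ennreal (first_passage L s \<omega> * first_passage L t \<omega>) \<partial>M)"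
      by (rule nn_integral_cong) (simp add: Y[OF st(1)] Y[OF t])
    then show ?thesis
      using first_passage_product_mean[OF st fp_meas[OF st(1)] fp_meas[OF t]] by (simp add: q_def)
  qed
  note right = poisson_order_right_continuous[OF N]
  have subord: "(\<integral>\<^sup>+\<omega>. \<phi> (real (N (Y s \<omega>) \<omega>), real (N (Y t \<omega>) \<omega>)) \<partial>M) =
      (\<integral>\<^sup>+\<omega>. (\<integral>\<^sup>+\<omega>'. \<phi> (real (N (Y s \<omega>) \<omega>'), real (N (Y t \<omega>) \<omega>')) \<partial>M) \<partial>M)"
    if "0 \<le> s" "0 \<le> t" "\<phi> \<in> borel_measurable (borel \<Otimes>\<^sub>M borel)" for s t \<phi>
    by (rule subordinated_process(2)[OF indep]) (fact right Y0 that)+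
  have Z_meas: "Z t \<in> borel_measurable M" if "0 \<le> t" for t
    unfolding Z_def[abs_def] by (rule subordinated_process(1)[OF indep]) (fact right Y0 that borel_measurable_const)+
  have mean_Z: "(\<integral>\<^sup>+\<omega>. ennreal (Z t \<omega>) \<partial>M) = ennreal (m * V t)" if t: "0 \<le> t" for t
  proof -
    have "(\<integral>\<^sup>+\<omega>. ennreal (Z t \<omega>) \<partial>M) = (\<integral>\<^sup>+\<omega>. (\<lambda>p. ennreal (fst p)) (real (N (Y t \<omega>) \<omega>), real (N (Y t \<omega>) \<omega>)) \<partial>M)"
      by (simp add: Z_def)
    also have "\<dots> = (\<integral>\<^sup>+\<omega>. (\<integral>\<^sup>+\<omega>'. (\<lambda>p. ennreal (fst p)) (real (N (Y t \<omega>) \<omega>'), real (N (Y t \<omega>) \<omega>')) \<partial>M) \<partial>M)"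
      by (rule subord[OF t t]) measurable
    also have "\<dots> = (\<integral>\<^sup>+\<omega>. ennreal m * ennreal (Y t \<omega>) \<partial>M)"
      using m poisson_order_moments(1)[OF N k l Y0[OF t] order_refl]
      by (intro nn_integral_cong) (simp add: m_def ennreal_mult'[symmetric])
    also have "\<dots> = ennreal m * ennreal (V t)"
      using Y_meas[OF t] by (subst nn_integral_cmult) (simp_all add: mean_Y[OF t])
    finally show ?thesis using m by (simp add: ennreal_mult')
  qed
  have prod_Z: "(\<integral>\<^sup>+\<omega>. ennreal (Z s \<omega> * Z t \<omega>) \<partial>M) = ennreal (v * V s + m\<^sup>2 * (q s t + q s s))"
    if st: "0 \<le> s" "s \<le> t" for s t
  proof -
    have t: "0 \<le> t" using st by simp
    have le: "AE \<omega> in M. Y s \<omega> \<le> Y t \<omega>"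
      using AE_first_passage_mono[OF st] AE_space by eventually_elim (simp add: Y[OF st(1)] Y[OF t])
    have "(\<integral>\<^sup>+\<omega>. ennreal (Z s \<omega> * Z t \<omega>) \<partial>M) =
        (\<integral>\<^sup>+\<omega>. (\<lambda>p. ennreal (fst p * snd p)) (real (N (Y s \<omega>) \<omega>), real (N (Y t \<omega>) \<omega>)) \<partial>M)"
      by (simp add: Z_def)
    also have "\<dots> = (\<integral>\<^sup>+\<omega>. (\<integral>\<^sup>+\<omega>'. (\<lambda>p. ennreal (fst p * snd p)) (real (N (Y s \<omega>) \<omega>'), real (N (Y t \<omega>) \<omega>')) \<partial>M) \<partial>M)"
      by (rule subord[OF st(1) t]) measurable
    also have "\<dots> = (\<integral>\<^sup>+\<omega>. ennreal v * ennreal (Y s \<omega>) + ennreal (m\<^sup>2) * ennreal (Y s \<omega> * Y t \<omega>) \<partial>M)"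
    proof (rule nn_integral_cong_AE)
      show "AE \<omega> in M. (\<integral>\<^sup>+\<omega>'. (\<lambda>p. ennreal (fst p * snd p)) (real (N (Y s \<omega>) \<omega>'), real (N (Y t \<omega>) \<omega>')) \<partial>M) =
          ennreal v * ennreal (Y s \<omega>) + ennreal (m\<^sup>2) * ennreal (Y s \<omega> * Y t \<omega>)"
        using le AE_space
      proof eventually_elim
        case (elim \<omega>)
        have y: "0 \<le> Y s \<omega>" "0 \<le> Y s \<omega> * Y t \<omega>"
          using Y0[OF st(1)] Y0[OF t] elim(2) by simp_all
        have "ennreal v * ennreal (Y s \<omega>) + ennreal (m\<^sup>2) * ennreal (Y s \<omega> * Y t \<omega>) =
            ennreal (v * Y s \<omega> + m\<^sup>2 * (Y s \<omega> * Y t \<omega>))"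
          using v y by (subst ennreal_plus) (simp_all add: ennreal_mult')
        then show ?case
          using poisson_order_moments(2)[OF N k l y(1) elim(1)] by (simp add: m_def v_def mult.assoc)
      qed
    qed
    also have "\<dots> = ennreal v * ennreal (V s) + ennreal (m\<^sup>2) * ennreal (q s t + q s s)"
      using Y_meas[OF st(1)] Y_meas[OF t]
      by (subst nn_integral_add; (subst nn_integral_cmult)?; simp add: nn_integral_cmult mean_Y[OF st(1)] prod_Y[OF st])
    also have "\<dots> = ennreal (v * V s + m\<^sup>2 * (q s t + q s s))"
      using v V0 q0 by (subst ennreal_plus) (simp_all add: ennreal_mult' del: ennreal_plus)
    finally show ?thesis .
  qed
  have Z0: "0 \<le> Z t \<omega>" for t \<omega> by (simp add: Z_def)
  have prod0: "0 \<le> v * V s + m\<^sup>2 * (q s t + q s s)" for s t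
    using v V0[of s] q0[of s t] q0[of s s] by simp
  have cov: "covariance M (Z s) (Z t) = v * V s + m\<^sup>2 * (q s s + (q s t - V s * V t))" if st: "0 \<le> s" "s \<le> t" for s t
  proof -
    have t: "0 \<le> t" using st by simp
    have "covariance M (Z s) (Z t) = v * V s + m\<^sup>2 * (q s t + q s s) - m * V s * (m * V t)"
      using m V0 by (intro covariance_nonneg_eq[OF Z_meas[OF st(1)] Z_meas[OF t] Z0 Z0
        mean_Z[OF st(1)] mean_Z[OF t] prod_Z[OF st] _ _ prod0]) auto
    then show ?thesis by (simp add: algebra_simps power2_eq_square)
  qed
  \<comment> \<open>\<open>Var (Y t) = K * t powr (2 * \<alpha>)\<close>.\<close>
  define K where "K = 2 * q 1 1 - 1 / G\<^sup>2"
  have K: "0 < K" using first_passage_variance_coefficient_pos[OF \<alpha>1] by (simp add: K_def q_def G_def)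
  have var: "covariance M (Z t) (Z t) = v / G * t powr \<alpha> + m\<^sup>2 * K * t powr (2 * \<alpha>)" if t: "0 < t" for t
  proof -
    have "t powr (2 * \<alpha>) = t powr \<alpha> * t powr \<alpha>" by (simp add: powr_add[symmetric])
    then have "V t * V t = 1 / G\<^sup>2 * t powr (2 * \<alpha>)" by (simp add: V_def power2_eq_square)
    moreover have "q t t = q 1 1 * t powr (2 * \<alpha>)"
      using correlation_potential_diagonal[OF t] by (simp add: q_def)
    ultimately have "q t t + (q t t - V t * V t) = K * t powr (2 * \<alpha>)"
      by (simp add: K_def algebra_simps)
    then show ?thesis using cov[of t t] t by (simp add: V_def)
  qed
  have square_integrable: "integrable M (\<lambda>\<omega>. (Z t \<omega>)\<^sup>2)" if t: "0 \<le> t" for t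
    using prod_Z[OF t order_refl] Z_meas[OF t]
    by (intro integrableI_nn_integral_finite[where x="v * V t + m\<^sup>2 * (q t t + q t t)"]) (auto simp: power2_eq_square)
  have "\<exists>c>0. ((\<lambda>t. correlation M (Z s) (Z t) / t powr (- \<alpha>)) \<longlongrightarrow> c) at_top" if s: "0 < s" for s
  proof -
    define C where "C = covariance M (Z s) (Z s)"
    \<comment> \<open>The limit of the covariance of \<open>Z s\<close> and \<open>Z t\<close> as \<open>t\<close> tends to infinity.\<close>
    define c where "c = v * V s + m\<^sup>2 * q s s"
    have C: "0 < C"
      using s v G m K by (auto simp: C_def var[OF s] intro!: add_pos_pos mult_pos_pos)
    have "0 < V s" using s G by (simp add: V_def)
    then have c: "0 < c" using v q0[of s s] by (auto simp: c_def intro!: add_pos_nonneg mult_pos_pos)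
    have "((\<lambda>t. v * V s + m\<^sup>2 * (q s s + (q s t - V s * V t))) \<longlongrightarrow> v * V s + m\<^sup>2 * (q s s + 0)) at_top"
      by (intro tendsto_intros correlation_potential_asymptotic[OF \<alpha>1 s, folded q_def G_def, folded V_def])
    then have "((\<lambda>t. v * V s + m\<^sup>2 * (q s s + (q s t - V s * V t))) \<longlongrightarrow> c) at_top" by (simp add: c_def)
    from tendsto_power_law_correlation[OF \<alpha>0 _ C this, of "m\<^sup>2 * K" "v / G"]
    have lim: "((\<lambda>t. (v * V s + m\<^sup>2 * (q s s + (q s t - V s * V t))) /
        sqrt (C * (v / G * t powr \<alpha> + m\<^sup>2 * K * t powr (2 * \<alpha>))) / t powr (- \<alpha>)) \<longlongrightarrow> c / sqrt (C * (m\<^sup>2 * K))) at_top"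
      using m K by simp
    have "((\<lambda>t. correlation M (Z s) (Z t) / t powr (- \<alpha>)) \<longlongrightarrow> c / sqrt (C * (m\<^sup>2 * K))) at_top"
    proof (rule Lim_transform_eventually[OF lim])
      show "\<forall>\<^sub>F t in at_top. (v * V s + m\<^sup>2 * (q s s + (q s t - V s * V t))) /
          sqrt (C * (v / G * t powr \<alpha> + m\<^sup>2 * K * t powr (2 * \<alpha>))) / t powr (- \<alpha>) =
        correlation M (Z s) (Z t) / t powr (- \<alpha>)"
        using eventually_ge_at_top[of s]
      proof eventually_elim
        case (elim t)
        then have "0 < t" using s by simp
        then show ?case
          using cov[OF less_imp_le[OF s] elim] var[of t] by (simp only: correlation_def C_def)
      qed
    qed
    then show ?thesis
      using c C m K by (intro exI[of _ "c / sqrt (C * (m\<^sup>2 * K))"]) simp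
  qed
  then show ?thesis
    unfolding long_range_dependent_def Z_def[symmetric]
    using Z_meas square_integrable \<alpha>0 \<alpha>1 by blast
qed

end
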